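(* For every $s\in(\sqrt2,2]$, the core $X'$ of the inverse limit space of the tent map $T_s$ admits a planar embedding with at least two non-degenerate fully accessible dense arc-components.
   Context: For $s\in(\sqrt2,2]$ let $T=T_s\colon[0,1]\to[0,1]$, $T_s(t)=\min\{st,s(1-t)\}$, $c=\frac12$. The core is $X'=\varprojlim([T^2(c),T(c)],T)=\{x\in[T^2(c),T(c)]^{-\mathbb N_0}: T(\pi_i(x))=\pi_{i+1}(x)\ \forall i<0\}$ with the product topology, $\pi_i$ being the coordinate projections. The arc-component of a point $x$ is the union of all arcs containing $x$; it is non-degenerate if it is not a single point, and dense if it is dense in $X'$. For a continuum $K\subset\mathbb R^2$, a point $a\in K$ is accessible if there is an arc $A\subset\mathbb R^2$ with $A\cap K=\{a\}$; an arc-component of $K$ is fully accessible if each of its points is accessible. *)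

theory Defs
  imports "HOL-Analysis.Analysis"
begin

definition tent :: "real \<Rightarrow> real \<Rightarrow> real" where
  "tent s t = min (s * t) (s * (1 - t))"

text \<open>
  A backward orbit \<open>(\<dots>, x\<^sub>-\<^sub>2, x\<^sub>-\<^sub>1, x\<^sub>0)\<close> is encoded as the function \<open>x :: nat \<Rightarrow> 'a\<close> whose
  value at \<open>n\<close> is the coordinate with index \<open>-n\<close>. The topology of the function type
  is the product topology.
\<close>

definition inverse_limit :: "'a set \<Rightarrow> ('a \<Rightarrow> 'a) \<Rightarrow> (nat \<Rightarrow> 'a) set" where
  "inverse_limit A f = {x. (\<forall>n. x n \<in> A) \<and> (\<forall>n. f (x (Suc n)) = x n)}"

definition tent_core :: "real \<Rightarrow> (nat \<Rightarrow> real) set" where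
  "tent_core s = inverse_limit {tent s (tent s (1/2)) .. tent s (1/2)} (tent s)"

text \<open>
  The constant \<open>arc\<close> of the library denotes parametrised, nondegenerate arcs. A single point counts as
  a degenerate arc, so a point on no nondegenerate arc has itself as its arc-component.
\<close>

definition arc_component :: "'a::topological_space set \<Rightarrow> 'a \<Rightarrow> 'a set" where
  "arc_component X x =
    insert x (\<Union>{path_image g | g. arc g \<and> path_image g \<subseteq> X \<and> x \<in> path_image g})"

definition arc_components :: "'a::topological_space set \<Rightarrow> 'a set set" where
  "arc_components X = arc_component X ` X"

definition nondegenerate :: "'a set \<Rightarrow> bool" where
  "nondegenerate C \<longleftrightarrow> (\<nexists>a. C = {a})"

definition dense_subset :: "'a::topological_space set \<Rightarrow> 'a set \<Rightarrow> bool" where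
  "dense_subset X C \<longleftrightarrow> C \<subseteq> X \<and> X \<subseteq> closure C"

definition accessible :: "(real^2) set \<Rightarrow> real^2 \<Rightarrow> bool" where
  "accessible K a \<longleftrightarrow> a \<in> K \<and> (\<exists>g. arc g \<and> path_image g \<inter> K = {a})"

definition fully_accessible :: "(real^2) set \<Rightarrow> (real^2) set \<Rightarrow> bool" where
  "fully_accessible K C \<longleftrightarrow> (\<forall>a\<in>C. accessible K a)"

definition planar_embedding :: "'a::topological_space set \<Rightarrow> ('a \<Rightarrow> real^2) \<Rightarrow> bool" where
  "planar_embedding X h \<longleftrightarrow> embedding_map (top_of_set X) euclidean h"

end

theory Submission
  imports Defs
begin

text \<open>
  Some iterate \<open>T ^^ N\<close> has two disjoint intervals \<open>P\<close> (left) and \<open>Q\<close> (right) that it maps affinely,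
  increasingly and onto the whole core interval. It factors as \<open>stretch \<circ> retract\<close>, where \<open>retract\<close> is
  the identity on the hull of \<open>P \<union> Q\<close> and folds what is to the left of the hull into \<open>P\<close> and what is to
  the right into \<open>Q\<close>. A backward orbit thus becomes an orbit \<open>z\<close> of alternating maps \<open>G k\<close>, which are
  unfolded by the Lozi-like plane homeomorphisms \<open>(x, y) \<mapsto> (G k x + q ^ k * y, x)\<close>: the equations
  \<open>X k = G k (X (k + 1)) + q ^ k * X (k + 2)\<close> have a unique solution close to \<open>z\<close>, and \<open>(X 0, X 1)\<close> is
  the image of the point in the plane.

  If \<open>e\<close> belongs to an orbit whose tail stays in \<open>P\<close>, then \<open>X n \<ge> e n\<close> and \<open>X (n + 1) \<le> e (n + 1)\<close> for
  a large even \<open>n\<close> are inherited by all later indices, with gaps of order \<open>q ^ k\<close>, so that \<open>X = e\<close>.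
  Hence a quadrant at \<open>(e n, e (n + 1))\<close> misses the rest of the continuum, which makes the point
  accessible; for \<open>Q\<close> the opposite quadrant does. Because the core map is locally eventually onto,
  the coordinates along any arc shrink to zero length. So the arc-components of the two orbits
  through the fixed points in \<open>P\<close> and \<open>Q\<close> consist of such tails; they are different, and dense.
\<close>

section \<open>Unfolding a sequence of interval maps in the plane\<close>

locale lozi_scheme =
  fixes G :: "nat \<Rightarrow> real \<Rightarrow> real" and L q :: real
  assumes lipschitz: "\<bar>G k x - G k y\<bar> \<le> L * \<bar>x - y\<bar>"
    and L_ge_1: "1 \<le> L" and q_pos: "0 < q" and small: "L * q + q \<le> 1/2"
begin

definition orbit :: "(nat \<Rightarrow> real) \<Rightarrow> bool" where
  "orbit z \<longleftrightarrow> (\<forall>k. \<bar>z k\<bar> \<le> 1) \<and> (\<forall>k. G k (z (Suc k)) = z k)"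

text \<open>Jacobi iteration for \<open>X k = G k (X (k + 1)) + q ^ k * X (k + 2)\<close>, started at an exact orbit.\<close>

primrec approx :: "(nat \<Rightarrow> real) \<Rightarrow> nat \<Rightarrow> nat \<Rightarrow> real" where
  "approx z 0 = z"
| "approx z (Suc m) = (\<lambda>k. G k (approx z m (Suc k)) + q ^ k * approx z m (Suc (Suc k)))"

text \<open>The limit is written as a telescoping series, so that one bound on the single steps
  gives summability, closeness to \<open>z\<close> and, by uniform convergence, continuity in a
  parameter.\<close>

definition soln :: "(nat \<Rightarrow> real) \<Rightarrow> nat \<Rightarrow> real" where
  "soln z k = z k + (\<Sum>m. approx z (Suc m) k - approx z m k)"

section \<open>Convergence of the iteration and continuity of its limit\<close>

lemma q_le_half: "q \<le> 1/2"
proof -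
  have "0 \<le> L * q" using L_ge_1 q_pos by simp
  then show ?thesis using small by linarith
qed

lemma Lq_le_half: "L * q \<le> 1/2"
  using small q_pos by linarith

lemma q_power_le_1: "q ^ k \<le> 1"
  using q_pos q_le_half by (intro power_le_one) auto

lemma continuous_G: "continuous_on S (G k)"
proof (rule continuous_onI)
  fix x e :: real assume "x \<in> S" "0 < e"
  have "dist (G k y) (G k x) \<le> e" if "dist y x < e / L" for y
  proof -
    have "dist (G k y) (G k x) \<le> L * \<bar>y - x\<bar>" using lipschitz[of k y x] by (simp add: dist_real_def)
    also have "\<dots> \<le> L * (e / L)" using that L_ge_1 by (intro mult_left_mono) (auto simp: dist_real_def)
    also have "\<dots> = e" using L_ge_1 by simp
    finally show ?thesis .
  qed
  moreover have "0 < e / L" using \<open>0 < e\<close> L_ge_1 by simp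
  ultimately show "\<exists>d>0. \<forall>x'\<in>S. dist x' x < d \<longrightarrow> dist (G k x') (G k x) \<le> e" by blast
qed

text \<open>A change at index \<open>k\<close> comes from changes at \<open>k + 1\<close> and
  \<open>k + 2\<close>, whose bounds carry extra factors of \<open>q\<close>. By
  \<open>L * q + q \<le> 1/2\<close> these outweigh the expansion of \<open>G k\<close>, so the
  bound halves in each round.\<close>

lemma approx_step:
  assumes "orbit z"
  shows "\<bar>approx z (Suc m) k - approx z m k\<bar> \<le> q ^ k * (1/2) ^ m"
proof (induction m arbitrary: k)
  case 0
  have "\<bar>q ^ k * z (Suc (Suc k))\<bar> \<le> q ^ k * 1"
    using assms q_pos unfolding orbit_def abs_mult by (intro mult_mono) auto
  then show ?case using assms by (simp add: orbit_def)
next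
  case (Suc m)
  let ?d = "\<lambda>k. approx z (Suc m) k - approx z m k"
  have "\<bar>approx z (Suc (Suc m)) k - approx z (Suc m) k\<bar>
      \<le> \<bar>G k (approx z (Suc m) (Suc k)) - G k (approx z m (Suc k))\<bar> + q ^ k * \<bar>?d (Suc (Suc k))\<bar>"
  proof -
    have "approx z (Suc (Suc m)) k - approx z (Suc m) k
      = (G k (approx z (Suc m) (Suc k)) - G k (approx z m (Suc k))) + q ^ k * ?d (Suc (Suc k))"
      by (simp add: algebra_simps)
    then have "\<bar>approx z (Suc (Suc m)) k - approx z (Suc m) k\<bar>
      \<le> \<bar>G k (approx z (Suc m) (Suc k)) - G k (approx z m (Suc k))\<bar> + \<bar>q ^ k * ?d (Suc (Suc k))\<bar>"
      using abs_triangle_ineq by (simp only:)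
    also have "\<bar>q ^ k * ?d (Suc (Suc k))\<bar> = q ^ k * \<bar>?d (Suc (Suc k))\<bar>"
      using q_pos by (simp only: abs_mult abs_of_pos zero_less_power)
    finally show ?thesis .
  qed
  also have "\<dots> \<le> L * \<bar>?d (Suc k)\<bar> + q ^ k * \<bar>?d (Suc (Suc k))\<bar>"
    by (intro add_right_mono lipschitz)
  also have "\<dots> \<le> L * (q ^ Suc k * (1/2) ^ m) + q ^ k * (q ^ Suc (Suc k) * (1/2) ^ m)"
    using L_ge_1 q_pos Suc.IH[of "Suc k"] Suc.IH[of "Suc (Suc k)"]
    by (intro add_mono mult_left_mono) auto
  also have "\<dots> = q ^ k * (1/2) ^ m * (L * q + q * (q * q ^ k))"
    by (simp add: algebra_simps)
  also have "\<dots> \<le> q ^ k * (1/2) ^ m * (1/2)"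
  proof (intro mult_left_mono)
    have "q * q ^ k \<le> 1 * 1" using q_le_half q_pos q_power_le_1 by (intro mult_mono) auto
    then have "q * (q * q ^ k) \<le> q * 1" using q_pos by (intro mult_left_mono) auto
    then show "L * q + q * (q * q ^ k) \<le> 1/2" using small by linarith
  qed (use q_pos in auto)
  finally show ?case by simp
qed

lemma step_summable:
  assumes "orbit z"
  shows "summable (\<lambda>m. approx z (Suc m) k - approx z m k)"
proof (rule summable_comparison_test')
  show "summable (\<lambda>m. q ^ k * (1/2) ^ m)" by (intro summable_mult summable_geometric) simp
  show "norm (approx z (Suc m) k - approx z m k) \<le> q ^ k * (1/2) ^ m" for m
    using approx_step[OF assms] by simp
qed

lemma approx_tendsto:
  assumes "orbit z"
  shows "(\<lambda>m. approx z m k) \<longlonglongrightarrow> soln z k"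
proof -
  have "(\<lambda>n. \<Sum>m<n. approx z (Suc m) k - approx z m k) \<longlonglongrightarrow> (\<Sum>m. approx z (Suc m) k - approx z m k)"
    by (intro summable_LIMSEQ step_summable assms)
  then have "(\<lambda>n. z k + (\<Sum>m<n. approx z (Suc m) k - approx z m k)) \<longlonglongrightarrow> soln z k"
    unfolding soln_def by (intro tendsto_intros)
  moreover have "z k + (\<Sum>m<n. approx z (Suc m) k - approx z m k) = approx z n k" for n
    by (subst sum_lessThan_telescope) simp
  ultimately show ?thesis by simp
qed

lemma soln_rec:
  assumes "orbit z"
  shows "soln z k = G k (soln z (Suc k)) + q ^ k * soln z (Suc (Suc k))"
proof (rule LIMSEQ_unique)
  show "(\<lambda>m. approx z (Suc m) k) \<longlonglongrightarrow> soln z k"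
    using approx_tendsto[OF assms] by (rule LIMSEQ_Suc)
  have "isCont (G k) x" for x
    using continuous_G[of UNIV k] by (simp add: continuous_on_eq_continuous_at)
  then have "(\<lambda>m. G k (approx z m (Suc k))) \<longlonglongrightarrow> G k (soln z (Suc k))"
    using approx_tendsto[OF assms] by (rule isCont_tendsto_compose)
  then show "(\<lambda>m. approx z (Suc m) k) \<longlonglongrightarrow> G k (soln z (Suc k)) + q ^ k * soln z (Suc (Suc k))"
    using approx_tendsto[OF assms] by (auto intro!: tendsto_intros)
qed

lemma soln_near:
  assumes "orbit z"
  shows "\<bar>soln z k - z k\<bar> \<le> 2 * q ^ k"
proof -
  have "norm (\<Sum>m. approx z (Suc m) k - approx z m k) \<le> (\<Sum>m. q ^ k * (1/2) ^ m)"
    using approx_step[OF assms]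
    by (intro norm_suminf_le summable_mult summable_geometric) (auto simp del: approx.simps)
  also have "\<dots> = 2 * q ^ k" by (subst suminf_mult) (auto simp: suminf_geometric)
  finally show ?thesis by (simp add: soln_def)
qed

lemma soln_bound:
  assumes "orbit z"
  shows "\<bar>soln z k\<bar> \<le> 3"
proof -
  have "\<bar>z k\<bar> \<le> 1" using assms by (simp add: orbit_def)
  then show ?thesis using soln_near[OF assms, of k] q_power_le_1[of k] by linarith
qed

lemma continuous_soln:
  assumes "\<And>k. continuous_on S (\<lambda>x. Z x k)" and "\<And>x. x \<in> S \<Longrightarrow> orbit (Z x)"
  shows "continuous_on S (\<lambda>x. soln (Z x) k)"
proof -
  have appr: "continuous_on S (\<lambda>x. approx (Z x) m k)" for m k
  proof (induction m arbitrary: k)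
    case (Suc m)
    have "continuous_on S (\<lambda>x. G k (approx (Z x) m (Suc k)))"
      by (rule continuous_on_compose2[OF continuous_G[of UNIV] Suc]) auto
    then show ?case using Suc by (auto intro!: continuous_intros)
  qed (use assms in auto)
  have "uniform_limit S (\<lambda>n x. \<Sum>m<n. approx (Z x) (Suc m) k - approx (Z x) m k)
      (\<lambda>x. \<Sum>m. approx (Z x) (Suc m) k - approx (Z x) m k) sequentially"
  proof (rule Weierstrass_m_test)
    show "summable (\<lambda>m. q ^ k * (1/2) ^ m)" by (intro summable_mult summable_geometric) simp
    show "norm (approx (Z x) (Suc m) k - approx (Z x) m k) \<le> q ^ k * (1/2) ^ m" if "x \<in> S" for m x
      using approx_step[OF assms(2)[OF that]] by simp
  qed
  then have "continuous_on S (\<lambda>x. \<Sum>m. approx (Z x) (Suc m) k - approx (Z x) m k)"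
    by (rule uniform_limit_theorem[rotated])
      (auto intro!: always_eventually continuous_intros appr simp del: approx.simps)
  then show ?thesis unfolding soln_def by (intro continuous_intros assms)
qed

section \<open>Uniqueness of solutions\<close>

lemma orbit_expand:
  assumes "orbit z" "orbit z'"
  shows "\<bar>z j - z' j\<bar> \<le> L ^ i * \<bar>z (j + i) - z' (j + i)\<bar>"
proof (induction i)
  case (Suc i)
  have "\<bar>z (j + i) - z' (j + i)\<bar> \<le> L * \<bar>z (j + Suc i) - z' (j + Suc i)\<bar>"
    using assms lipschitz[of "j + i" "z (Suc (j + i))" "z' (Suc (j + i))"] by (simp add: orbit_def)
  then have "L ^ i * \<bar>z (j + i) - z' (j + i)\<bar> \<le> L ^ i * (L * \<bar>z (j + Suc i) - z' (j + Suc i)\<bar>)"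
    using L_ge_1 by (intro mult_left_mono) auto
  then show ?case using Suc by (simp add: algebra_simps)
qed auto

text \<open>Solutions lie within \<open>2 * q ^ k\<close> of their orbits, so the orbits are also
  within order \<open>q ^ k\<close> of each other at infinitely many indices. Pulling this back over
  \<open>i\<close> indices costs \<open>L ^ i\<close>, and \<open>(L * q) ^ i\<close> tends to
  zero.\<close>

lemma close_imp_eq:
  assumes z: "orbit z" "orbit z'"
    and close: "\<exists>\<^sub>F k in sequentially. \<bar>soln z k - soln z' k\<bar> \<le> C * q ^ k"
  shows "z = z'"
proof
  fix j
  define D where "D = \<bar>C\<bar> + 4"
  have bound: "\<bar>z j - z' j\<bar> \<le> D * (1/2) ^ i" if i: "\<bar>soln z (j + i) - soln z' (j + i)\<bar> \<le> C * q ^ (j + i)" for i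
  proof -
    have "C * q ^ (j + i) \<le> \<bar>C\<bar> * q ^ (j + i)"
      using q_pos by (intro mult_right_mono) auto
    then have "\<bar>z (j + i) - z' (j + i)\<bar> \<le> D * q ^ (j + i)"
      using i soln_near[OF z(1), of "j + i"] soln_near[OF z(2), of "j + i"]
      unfolding D_def distrib_right by linarith
    also have "\<dots> \<le> D * q ^ i"
      using q_power_le_1[of j] q_pos
      by (auto simp: D_def power_add intro!: mult_left_mono mult_left_le_one_le)
    finally have "L ^ i * \<bar>z (j + i) - z' (j + i)\<bar> \<le> L ^ i * (D * q ^ i)"
      using L_ge_1 by (intro mult_left_mono) auto
    also have "\<dots> = D * (L * q) ^ i" by (simp add: power_mult_distrib)
    also have "\<dots> \<le> D * (1/2) ^ i"
      using Lq_le_half L_ge_1 q_pos by (intro mult_left_mono power_mono) (auto simp: D_def)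
    finally show ?thesis using orbit_expand[OF z, of j i] by linarith
  qed
  have "\<not> 0 < \<bar>z j - z' j\<bar>"
  proof
    assume "0 < \<bar>z j - z' j\<bar>"
    moreover have "(\<lambda>i. D * (1/2) ^ i) \<longlonglongrightarrow> D * 0" by (intro tendsto_intros LIMSEQ_power_zero) simp
    ultimately have "\<forall>\<^sub>F i in sequentially. D * (1/2) ^ i < \<bar>z j - z' j\<bar>"
      by (intro order_tendstoD(2)[where y = "D * 0"]) auto
    then obtain i0 where i0: "\<And>i. i \<ge> i0 \<Longrightarrow> D * (1/2) ^ i < \<bar>z j - z' j\<bar>"
      by (auto simp: eventually_sequentially)
    obtain k where k: "k \<ge> j + i0" "\<bar>soln z k - soln z' k\<bar> \<le> C * q ^ k"
      using close by (auto simp: frequently_sequentially)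
    then have "i0 \<le> k - j" "j + (k - j) = k" by auto
    then show False using bound[of "k - j"] i0[of "k - j"] k by fastforce
  qed
  then show "z j = z' j" by simp
qed

text \<open>As \<open>q ^ k\<close> is nonzero, the recurrence can be solved for the term at
  \<open>k + 2\<close>. So two consecutive terms fix all later ones, and solutions that coincide
  have the same orbit. This makes the drawing in the plane injective.\<close>

lemma soln_determined:
  assumes z: "orbit z" "orbit z'"
    and "soln z 0 = soln z' 0" "soln z (Suc 0) = soln z' (Suc 0)"
  shows "z = z'"
proof -
  have "soln z k = soln z' k \<and> soln z (Suc k) = soln z' (Suc k)" for k
  proof (induction k)
    case (Suc k)
    then have "G k (soln z (Suc k)) = G k (soln z' (Suc k))" by simp
    with Suc have "q ^ k * soln z (Suc (Suc k)) = q ^ k * soln z' (Suc (Suc k))"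
      using soln_rec[OF z(1), of k] soln_rec[OF z(2), of k] by linarith
    then show ?case using Suc q_pos by simp
  qed (use assms in auto)
  then show ?thesis by (intro close_imp_eq[OF z, of 0]) auto
qed

section \<open>Unfolding maps of the plane and accessible points\<close>

primrec unfolding_map :: "nat \<Rightarrow> real \<times> real \<Rightarrow> real \<times> real" where
  "unfolding_map 0 = id"
| "unfolding_map (Suc n) = (\<lambda>(x, y). unfolding_map n (G n x + q ^ n * y, x))"

text \<open>\<open>unfolding_map n\<close> composes the first \<open>n\<close> Lozi-like maps, each
  of which lowers the index of a pair of consecutive terms by one.\<close>

lemma unfolding_map_soln:
  assumes "orbit z"
  shows "unfolding_map n (soln z n, soln z (Suc n)) = (soln z 0, soln z (Suc 0))"
proof (induction n)
  case (Suc n)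
  have "G n (soln z (Suc n)) + q ^ n * soln z (Suc (Suc n)) = soln z n"
    using soln_rec[OF assms, of n] by (rule sym)
  then show ?case using Suc by (simp only: unfolding_map.simps prod.case)
qed simp

lemma inj_unfolding_map: "inj (unfolding_map n)"
proof (induction n)
  case (Suc n)
  show ?case
  proof (rule injI)
    fix p p' assume "unfolding_map (Suc n) p = unfolding_map (Suc n) p'"
    then have "(G n (fst p) + q ^ n * snd p, fst p) = (G n (fst p') + q ^ n * snd p', fst p')"
      by (subst inj_eq[OF Suc, symmetric]) (simp add: case_prod_beta)
    then show "p = p'" using q_pos by (auto simp: prod_eq_iff)
  qed
qed simp

lemma continuous_unfolding_map: "continuous_on S (unfolding_map n)"
proof (induction n arbitrary: S)
  case (Suc n)
  have "continuous_on UNIV (\<lambda>p. (G n (fst p) + q ^ n * snd p, fst p))"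
    by (intro continuous_intros continuous_on_compose2[OF continuous_G[of UNIV]]) auto
  then have "continuous_on UNIV (\<lambda>p. unfolding_map n (G n (fst p) + q ^ n * snd p, fst p))"
    by (rule continuous_on_compose2[OF Suc]) auto
  then show ?case by (auto simp: case_prod_beta intro: continuous_on_subset)
qed (auto simp: id_def)

definition plane_point :: "real \<times> real \<Rightarrow> real^2" where
  "plane_point p = vector [fst p, snd p]"

lemma plane_point_eq_iff [simp]: "plane_point p = plane_point p' \<longleftrightarrow> p = p'"
proof
  assume "plane_point p = plane_point p'"
  then have "plane_point p $ 1 = plane_point p' $ 1" "plane_point p $ 2 = plane_point p' $ 2" by auto
  then show "p = p'" by (simp add: plane_point_def prod_eq_iff)
qed simp

lemma continuous_plane_point [continuous_intros]:
  assumes "continuous_on S f"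
  shows "continuous_on S (\<lambda>x. plane_point (f x))"
proof -
  have eq: "plane_point p = fst p *\<^sub>R axis 1 1 + snd p *\<^sub>R axis 2 1" for p
    by (simp add: plane_point_def vec_eq_iff forall_2 axis_def)
  show ?thesis unfolding eq by (intro continuous_intros assms)
qed

definition draw :: "(nat \<Rightarrow> real) \<Rightarrow> real^2" where
  "draw z = plane_point (soln z 0, soln z (Suc 0))"

lemma draw_eq_iff:
  assumes "orbit z" "orbit z'"
  shows "draw z = draw z' \<longleftrightarrow> z = z'"
  using soln_determined[OF assms] by (auto simp: draw_def)

text \<open>A diagonal segment that enters a quadrant at the \<open>n\<close>-th pair of terms is
  carried to the plane of the drawing by the injective \<open>unfolding_map n\<close>. The corner
  condition keeps it away from the pairs of all other orbits; the sign of \<open>\<sigma>\<close>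
  selects the quadrant.\<close>

lemma accessible_draw:
  assumes S: "\<And>z. z \<in> S \<Longrightarrow> orbit z" and z: "z \<in> S" and \<sigma>: "\<sigma> \<noteq> 0"
    and corner: "\<And>z'. z' \<in> S \<Longrightarrow> 0 \<le> \<sigma> * (soln z' n - soln z n) \<Longrightarrow>
      \<sigma> * (soln z' (Suc n) - soln z (Suc n)) \<le> 0 \<Longrightarrow> z' = z"
  shows "accessible (draw ` S) (draw z)"
proof -
  define g where "g t = plane_point (unfolding_map n (soln z n + \<sigma> * t, soln z (Suc n) - \<sigma> * t))" for t
  have "arc g"
    unfolding arc_def path_def
  proof
    show "continuous_on {0..1} g"
      unfolding g_def
      by (intro continuous_intros continuous_on_compose2[OF continuous_unfolding_map[of UNIV]]) auto
    show "inj_on g {0..1}"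
      using \<sigma> by (auto simp: g_def inj_on_def inj_eq[OF inj_unfolding_map])
  qed
  moreover have g0: "g 0 = draw z"
    using unfolding_map_soln[OF S[OF z]] by (simp add: g_def draw_def)
  moreover have "g t = draw z" if t: "t \<in> {0..1}" and g: "g t \<in> draw ` S" for t
  proof -
    obtain z' where z': "z' \<in> S" "g t = draw z'" using g by auto
    then have "unfolding_map n (soln z n + \<sigma> * t, soln z (Suc n) - \<sigma> * t) =
        unfolding_map n (soln z' n, soln z' (Suc n))"
      using unfolding_map_soln[OF S[OF z'(1)], of n] by (simp add: g_def draw_def)
    then have "soln z' n = soln z n + \<sigma> * t" "soln z' (Suc n) = soln z (Suc n) - \<sigma> * t"
      by (auto simp: inj_eq[OF inj_unfolding_map])
    then have "z' = z"
      using corner[OF z'(1)] t by (auto simp: mult.assoc[symmetric])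
    then show ?thesis using z' by simp
  qed
  ultimately have "path_image g \<inter> draw ` S = {draw z}"
    using z by (force simp: path_image_def)
  then show ?thesis using \<open>arc g\<close> z unfolding accessible_def by blast
qed

text \<open>
  Since \<open>q ^ k > 0\<close>, the equation at \<open>k\<close> turns the signs of the gaps at \<open>k\<close> and \<open>k + 1\<close> into the sign
  of the gap at \<open>k + 2\<close>; the slope \<open>c\<close> at even steps bounds the gap at \<open>k + 1\<close> by a multiple of \<open>q ^ k\<close>.
\<close>

lemma corner_imp_eq:
  assumes z: "orbit z" "orbit z'" and "0 < c"
    and even_steps: "\<And>m x. m \<ge> i \<Longrightarrow> \<bar>x\<bar> \<le> 3 \<Longrightarrow> \<sigma> * (x - soln z (Suc (2*m))) \<le> 0 \<Longrightarrow>
      \<sigma> * (G (2*m) x - G (2*m) (soln z (Suc (2*m)))) \<le> c * (\<sigma> * (x - soln z (Suc (2*m))))"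
    and odd_steps: "\<And>m x. m \<ge> i \<Longrightarrow> \<bar>x\<bar> \<le> 3 \<Longrightarrow> 0 \<le> \<sigma> * (x - soln z (2 * Suc m)) \<Longrightarrow>
      0 \<le> \<sigma> * (G (Suc (2*m)) x - G (Suc (2*m)) (soln z (2 * Suc m)))"
    and "0 \<le> \<sigma> * (soln z' (2*i) - soln z (2*i))"
    and "\<sigma> * (soln z' (Suc (2*i)) - soln z (Suc (2*i))) \<le> 0" and \<sigma>: "\<bar>\<sigma>\<bar> = 1"
  shows "z' = z"
proof -
  define d where "d k = \<sigma> * (soln z' k - soln z k)" for k
  have rec: "d k = \<sigma> * (G k (soln z' (Suc k)) - G k (soln z (Suc k))) + q ^ k * d (Suc (Suc k))" for k
    using soln_rec[OF z(1), of k] soln_rec[OF z(2), of k] unfolding d_def by (simp add: algebra_simps)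
  have d6: "\<bar>d k\<bar> \<le> 6" for k
    using soln_bound[OF z(1), of k] soln_bound[OF z(2), of k] \<sigma> unfolding d_def abs_mult by auto
  have inv: "0 \<le> d (2*m) \<and> d (Suc (2*m)) \<le> 0" if "i \<le> m" for m
    using that
  proof (induction m rule: dec_induct)
    case base
    then show ?case using assms by (simp add: d_def)
  next
    case (step m)
    have "\<sigma> * (G (2*m) (soln z' (Suc (2*m))) - G (2*m) (soln z (Suc (2*m)))) \<le> c * d (Suc (2*m))"
      unfolding d_def using step soln_bound[OF z(2)] by (intro even_steps) (auto simp: d_def)
    also have "\<dots> \<le> 0" using step \<open>0 < c\<close> by (simp add: mult_nonneg_nonpos)
    finally have "0 \<le> q ^ (2*m) * d (Suc (Suc (2*m)))" using rec[of "2*m"] step by linarith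
    then have 1: "0 \<le> d (2 * Suc m)" using zero_less_power[OF q_pos, of "2 * m"] by (simp add: zero_le_mult_iff not_le[symmetric])
    have "0 \<le> \<sigma> * (G (Suc (2*m)) (soln z' (2 * Suc m)) - G (Suc (2*m)) (soln z (2 * Suc m)))"
      using step 1 soln_bound[OF z(2)] by (intro odd_steps) (auto simp: d_def)
    then have "q ^ Suc (2*m) * d (Suc (2 * Suc m)) \<le> 0" using rec[of "Suc (2*m)"] step by (simp del: power_Suc)
    then have "d (Suc (2 * Suc m)) \<le> 0" using zero_less_power[OF q_pos, of "Suc (2 * m)"]
      by (simp add: mult_le_0_iff not_le[symmetric] del: power_Suc)
    with 1 show ?case by simp
  qed
  \<comment> \<open>The gaps are at most 6 because solutions are bounded by 3. The \<open>c\<close>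
    comes from the slope at even steps, and the \<open>q\<close> in the denominator turns
    \<open>q ^ (2*m)\<close> into the power at the odd index.\<close>
  have close: "\<bar>soln z (Suc (2*m)) - soln z' (Suc (2*m))\<bar> \<le> 6 / (c * q) * q ^ Suc (2*m)" if "i \<le> m" for m
  proof -
    have "\<sigma> * (G (2*m) (soln z' (Suc (2*m))) - G (2*m) (soln z (Suc (2*m)))) \<le> c * d (Suc (2*m))"
      unfolding d_def using that inv[OF that] soln_bound[OF z(2)] by (intro even_steps) (auto simp: d_def)
    then have "c * \<bar>d (Suc (2*m))\<bar> \<le> q ^ (2*m) * d (2 * Suc m)"
      using rec[of "2*m"] inv[OF that] abs_of_nonpos[of "d (Suc (2*m))"] by simp
    also have "\<dots> \<le> q ^ (2*m) * 6" using d6[of "2 * Suc m"] q_pos by (intro mult_left_mono) auto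
    finally have "\<bar>d (Suc (2*m))\<bar> \<le> q ^ (2*m) * 6 / c"
      using \<open>0 < c\<close> by (simp add: pos_le_divide_eq mult.commute)
    moreover have "\<bar>soln z (Suc (2*m)) - soln z' (Suc (2*m))\<bar> = \<bar>d (Suc (2*m))\<bar>"
      using \<sigma> by (simp add: d_def abs_mult abs_minus_commute)
    ultimately show ?thesis using q_pos by (simp add: field_simps)
  qed
  have "\<exists>\<^sub>F k in sequentially. \<bar>soln z k - soln z' k\<bar> \<le> 6 / (c * q) * q ^ k"
    unfolding frequently_sequentially
  proof
    fix n
    have "Suc (2 * (n + i)) \<ge> n" by simp
    then show "\<exists>k\<ge>n. \<bar>soln z k - soln z' k\<bar> \<le> 6 / (c * q) * q ^ k"
      using close[of "n + i"] by (intro exI[of _ "Suc (2 * (n + i))"]) auto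
  qed
  from close_imp_eq[OF z this] show ?thesis by simp
qed

end

section \<open>The tent map on its core\<close>

locale tent_map =
  fixes s :: real
  assumes s_gt: "sqrt 2 < s" and s_le_2: "s \<le> 2"
begin

abbreviation T :: "real \<Rightarrow> real" where "T \<equiv> tent s"

definition lo :: real where "lo = T (T (1/2))"
definition hi :: real where "hi = T (1/2)"

lemma s_gt_1: "1 < s"
proof -
  have "1 < sqrt 2" by simp
  then show ?thesis using s_gt by linarith
qed

lemma s_square: "2 < s * s"
proof -
  have "sqrt 2 * sqrt 2 < s * s" using s_gt s_gt_1 by (intro mult_strict_mono) auto
  then show ?thesis by simp
qed

lemma T_left: "x \<le> 1/2 \<Longrightarrow> T x = s * x"
  using s_gt_1 by (simp add: tent_def)

lemma T_right: "1/2 \<le> x \<Longrightarrow> T x = s * (1 - x)"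
  using s_gt_1 by (simp add: tent_def)

lemma hi_eq: "hi = s / 2"
  by (simp add: hi_def T_left)

lemma lo_eq: "lo = s * (1 - s / 2)"
  using s_gt_1 by (simp add: lo_def hi_def[symmetric] hi_eq T_right)

lemma lo_less: "lo < 1/2"
proof -
  have "0 < (s - 1) * (s - 1)" using s_gt_1 by simp
  then show ?thesis by (simp add: lo_eq field_simps)
qed

lemma hi_greater: "1/2 < hi"
  using s_gt_1 by (simp add: hi_eq)

lemma lo_nonneg: "0 \<le> lo"
  using s_gt_1 s_le_2 by (simp add: lo_eq)

lemma hi_le_1: "hi \<le> 1"
  using s_le_2 by (simp add: hi_eq)

lemma lo_less_hi: "lo < hi"
  using lo_less hi_greater by linarith

lemma T_core:
  assumes "x \<in> {lo..hi}"
  shows "T x \<in> {lo..hi}"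
proof (cases "x \<le> 1/2")
  case True
  have "1 * lo \<le> s * lo" using s_gt_1 lo_nonneg by (intro mult_right_mono) auto
  also have "s * lo \<le> s * x" using assms s_gt_1 by simp
  finally show ?thesis using True s_gt_1 by (simp add: T_left hi_eq)
next
  case False
  then have "s * (1 - hi) \<le> s * (1 - x)" "s * (1 - x) \<le> s * (1/2)"
    using assms s_gt_1 by (intro mult_left_mono; simp)+
  then show ?thesis using False by (simp add: T_right lo_eq hi_eq)
qed

lemma iterate_core: "x \<in> {lo..hi} \<Longrightarrow> (T ^^ m) x \<in> {lo..hi}"
  by (induction m) (use T_core in auto)

lemma T_lipschitz: "\<bar>T x - T y\<bar> \<le> s * \<bar>x - y\<bar>"
proof -
  have eq: "T x = s / 2 - s * \<bar>x - 1/2\<bar>" for x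
    by (cases "x \<le> 1/2") (auto simp: T_left T_right algebra_simps)
  have "T x - T y = s * (\<bar>y - 1/2\<bar> - \<bar>x - 1/2\<bar>)" unfolding eq[of x] eq[of y] by (simp add: algebra_simps)
  then have "\<bar>T x - T y\<bar> = s * \<bar>\<bar>y - 1/2\<bar> - \<bar>x - 1/2\<bar>\<bar>" using s_gt_1 by (simp add: abs_mult)
  also have "\<dots> \<le> s * \<bar>x - y\<bar>" using s_gt_1 by (intro mult_left_mono) auto
  finally show ?thesis .
qed

lemma iterate_lipschitz: "\<bar>(T ^^ m) x - (T ^^ m) y\<bar> \<le> s ^ m * \<bar>x - y\<bar>"
proof (induction m)
  case (Suc m)
  have "\<bar>(T ^^ Suc m) x - (T ^^ Suc m) y\<bar> \<le> s * \<bar>(T ^^ m) x - (T ^^ m) y\<bar>"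
    using T_lipschitz by simp
  also have "\<dots> \<le> s * (s ^ m * \<bar>x - y\<bar>)" using Suc s_gt_1 by (intro mult_left_mono) auto
  finally show ?case by (simp add: mult.assoc)
qed simp

lemma continuous_T: "continuous_on S T"
  unfolding tent_def[abs_def] by (intro continuous_intros)

lemma continuous_iterate: "continuous_on S (T ^^ m)"
proof (induction m)
  case (Suc m)
  then show ?case using continuous_on_compose[OF Suc continuous_T] by (simp add: comp_def)
qed (simp add: id_def)

section \<open>Growth of intervals under the tent map\<close>

lemma T_image_interval:
  assumes "u \<in> {x..y}" "v \<in> {x..y}"
  shows "{T u..T v} \<subseteq> T ` {x..y}"
proof -
  have "connected (T ` {x..y})"
    by (intro connected_continuous_image continuous_T) simp
  then show ?thesis using assms by (intro connected_contains_Icc) auto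
qed

lemma T_right_onto: "{lo..hi} \<subseteq> T ` {1/2..hi}"
  using T_image_interval[of hi "1/2" hi "1/2"] hi_greater unfolding lo_def hi_def by simp

lemma T_onto: "{lo..hi} \<subseteq> T ` {lo..hi}"
  using T_right_onto lo_less image_mono[of "{1/2..hi}" "{lo..hi}" T] by fastforce

text \<open>Without the turning point inside, the whole length grows by \<open>s\<close>. With it,
  the longer of the two halves still gives \<open>s / 2\<close>, and then the image interval ends at
  \<open>hi\<close>.\<close>

lemma T_stretch:
  assumes "lo \<le> x" "x < y" "y \<le> hi"
  obtains x' y' where "lo \<le> x'" "x' < y'" "y' \<le> hi" "{x'..y'} \<subseteq> T ` {x..y}"
    "s * (y - x) \<le> y' - x' \<or> y' = hi \<and> s / 2 * (y - x) \<le> y' - x'"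
proof -
  have core: "T u \<in> {lo..hi}" if "u \<in> {x..y}" for u
    using that assms by (intro T_core) auto
  have sub: "{T u..T v} \<subseteq> T ` {x..y}" if "u \<in> {x..y}" "v \<in> {x..y}" for u v
    using that by (rule T_image_interval)
  have pos: "0 < s * (y - x)" using assms s_gt_1 by simp
  consider "y \<le> 1/2" | "1/2 \<le> x" | "x < 1/2" "1/2 < y" by linarith
  then show thesis
  proof cases
    case 1
    then have "T y - T x = s * (y - x)" using assms by (simp add: T_left algebra_simps)
    then show thesis using that[of "T x" "T y"] core[of x] core[of y] sub[of x y] pos assms by auto
  next
    case 2
    then have "T x - T y = s * (y - x)" using assms by (simp add: T_right algebra_simps)
    then show thesis using that[of "T y" "T x"] core[of x] core[of y] sub[of y x] pos assms by auto
  next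
    case 3
    define u where "u = (if 1/2 - x \<ge> y - 1/2 then x else y)"
    have "s * ((y - x) / 2) \<le> s * \<bar>u - 1/2\<bar>"
      using s_gt_1 3 by (intro mult_left_mono) (auto simp: u_def)
    also have "\<dots> = hi - T u" using 3 by (auto simp: u_def hi_eq T_left T_right algebra_simps)
    finally have len: "s / 2 * (y - x) \<le> hi - T u" by simp
    moreover have "u \<in> {x..y}" using 3 by (auto simp: u_def)
    moreover have "{T u..hi} \<subseteq> T ` {x..y}"
      using sub[OF \<open>u \<in> {x..y}\<close>, of "1/2"] 3 by (simp add: hi_def)
    ultimately show thesis using that[of "T u" hi] core[of u] pos by auto
  qed
qed

text \<open>A fold leaves an interval that ends at \<open>hi\<close>. If it reaches down to
  \<open>1/2\<close>, its image is the whole core interval; otherwise it lies in one lap and is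
  stretched by the full \<open>s\<close>. So at most one of two steps loses the factor 2, unless
  everything is covered.\<close>

lemma T2_stretch:
  assumes "lo \<le> x" "x < y" "y \<le> hi"
  obtains x' y' where "lo \<le> x'" "x' < y'" "y' \<le> hi" "{x'..y'} \<subseteq> (T ^^ 2) ` {x..y}"
    "s * s / 2 * (y - x) \<le> y' - x' \<or> {x'..y'} = {lo..hi}"
proof -
  obtain u v where uv: "lo \<le> u" "u < v" "v \<le> hi" "{u..v} \<subseteq> T ` {x..y}"
      "s * (y - x) \<le> v - u \<or> v = hi \<and> s / 2 * (y - x) \<le> v - u"
    using T_stretch[OF assms] by metis
  have T2: "T ` {u..v} \<subseteq> (T ^^ 2) ` {x..y}"
    using uv(4) by (auto simp: numeral_2_eq_2 image_image[symmetric])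
  show thesis
  proof (cases "v = hi \<and> u \<le> 1/2")
    case True
    then have "{lo..hi} \<subseteq> T ` {u..v}" using T_right_onto by (fastforce intro: image_mono)
    then show thesis using that[of lo hi] T2 lo_less_hi by blast
  next
    case False
    obtain x' y' where xy: "lo \<le> x'" "x' < y'" "y' \<le> hi" "{x'..y'} \<subseteq> T ` {u..v}"
        "s * (v - u) \<le> y' - x' \<or> y' = hi \<and> s / 2 * (v - u) \<le> y' - x'"
      using T_stretch[OF uv(1-3)] by metis
    show thesis
    proof (cases "s * (y - x) \<le> v - u")
      case True
      have "0 \<le> s / 2 * (v - u)" using uv s_gt_1 by simp
      moreover have "s / 2 * (s * (y - x)) \<le> s / 2 * (v - u)" using True s_gt_1 by (intro mult_left_mono) auto
      moreover have "s * (v - u) = s / 2 * (v - u) + s / 2 * (v - u)" by simp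
      moreover have "s * s / 2 * (y - x) = s / 2 * (s * (y - x))" by simp
      ultimately have "s * s / 2 * (y - x) \<le> y' - x'" using xy(5) by linarith
      then show thesis using that[of x' y'] xy T2 by blast
    next
      case nT: False
      then have "1/2 < u" "v = hi" and len: "s / 2 * (y - x) \<le> v - u" using uv False by auto
      then have "T u - T v = s * (v - u)" using uv by (simp add: T_right algebra_simps)
      moreover have "s * (s / 2 * (y - x)) \<le> s * (v - u)" using len s_gt_1 by (intro mult_left_mono) auto
      moreover have "0 < s * (v - u)" using uv s_gt_1 by simp
      moreover have "{T v..T u} \<subseteq> T ` {u..v}" using uv by (intro T_image_interval) auto
      moreover have "T u \<in> {lo..hi}" "T v \<in> {lo..hi}" using uv by (intro T_core; simp)+
      ultimately show thesis using that[of "T v" "T u"] T2 by (auto simp: algebra_simps)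
    qed
  qed
qed

lemma iterate_onto_mono:
  assumes "{lo..hi} \<subseteq> (T ^^ m) ` S" "m \<le> m'"
  shows "{lo..hi} \<subseteq> (T ^^ m') ` S"
  using assms(2,1)
proof (induction rule: dec_induct)
  case (step n)
  have "{lo..hi} \<subseteq> T ` (T ^^ n) ` S" using T_onto image_mono[OF step.IH[OF assms(1)], of T] by blast
  then show ?case by (simp add: image_comp)
qed

text \<open>Every two steps gain the factor \<open>s * s / 2 > 1\<close> until the core interval is
  covered, and covering persists because \<open>T\<close> maps the core interval onto
  itself.\<close>

lemma locally_eventually_onto:
  assumes "0 < e"
  obtains M where "\<And>m x y. M \<le> m \<Longrightarrow> lo \<le> x \<Longrightarrow> y \<le> hi \<Longrightarrow> e \<le> y - x \<Longrightarrow> {lo..hi} \<subseteq> (T ^^ m) ` {x..y}"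
proof -
  define k where "k = s * s / 2"
  have "1 < k" using s_square by (simp add: k_def)
  \<comment> \<open>Growth of the length \<open>e\<close> by \<open>k ^ n\<close> would exceed 1,
    hence the length of the core interval; only covering remains possible.\<close>
  then obtain n where n: "1 / e < k ^ n" using real_arch_pow by blast
  have grow: "\<exists>x' y'. lo \<le> x' \<and> x' < y' \<and> y' \<le> hi \<and> {x'..y'} \<subseteq> (T ^^ (2 * i)) ` {x..y} \<and>
      (k ^ i * (y - x) \<le> y' - x' \<or> {x'..y'} = {lo..hi})"
    if "lo \<le> x" "x < y" "y \<le> hi" for i x y
  proof (induction i)
    case 0
    then show ?case using that by force
  next
    case (Suc i)
    then obtain u v where uv: "lo \<le> u" "u < v" "v \<le> hi" "{u..v} \<subseteq> (T ^^ (2 * i)) ` {x..y}"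
      "k ^ i * (y - x) \<le> v - u \<or> {u..v} = {lo..hi}" by blast
    have sub: "(T ^^ 2) ` {u..v} \<subseteq> (T ^^ (2 * Suc i)) ` {x..y}"
      using uv(4) by (auto simp: image_comp[symmetric] numeral_2_eq_2)
    show ?case
    proof (cases "{u..v} = {lo..hi}")
      case True
      then have "{lo..hi} \<subseteq> (T ^^ 2) ` {u..v}" using iterate_onto_mono[of 0 "{u..v}" 2] by (metis image_id funpow_0 id_apply image_cong le0 order_refl)
      then show ?thesis using sub lo_less_hi by blast
    next
      case False
      obtain x' y' where xy: "lo \<le> x'" "x' < y'" "y' \<le> hi" "{x'..y'} \<subseteq> (T ^^ 2) ` {u..v}"
        "k * (v - u) \<le> y' - x' \<or> {x'..y'} = {lo..hi}"
        using T2_stretch[OF uv(1-3)] unfolding k_def by metis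
      have "k * (k ^ i * (y - x)) \<le> k * (v - u)"
        using uv(5) False \<open>1 < k\<close> by (intro mult_left_mono) auto
      then have "k ^ Suc i * (y - x) \<le> y' - x' \<or> {x'..y'} = {lo..hi}"
        using xy(5) by (auto simp: mult.assoc)
      then show ?thesis using xy sub by blast
    qed
  qed
  show thesis
  proof (rule that[of "2 * n"])
    fix m x y assume m: "2 * n \<le> m" and xy: "lo \<le> x" "y \<le> hi" "e \<le> y - x"
    then obtain x' y' where *: "lo \<le> x'" "x' < y'" "y' \<le> hi" "{x'..y'} \<subseteq> (T ^^ (2 * n)) ` {x..y}"
      "k ^ n * (y - x) \<le> y' - x' \<or> {x'..y'} = {lo..hi}" using grow[of x y n] \<open>0 < e\<close> by auto
    have "1 < k ^ n * e" using n \<open>0 < e\<close> by (simp add: field_simps)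
    also have "\<dots> \<le> k ^ n * (y - x)" using xy \<open>1 < k\<close> by (intro mult_left_mono) auto
    finally have "\<not> k ^ n * (y - x) \<le> y' - x'" using * lo_nonneg hi_le_1 by linarith
    then have "{lo..hi} \<subseteq> (T ^^ (2 * n)) ` {x..y}" using * by blast
    then show "{lo..hi} \<subseteq> (T ^^ m) ` {x..y}" using m by (rule iterate_onto_mono)
  qed
qed

section \<open>Coordinates along paths in the core\<close>

lemma core_iterate:
  assumes "x \<in> tent_core s"
  shows "(T ^^ m) (x (n + m)) = x n"
proof (induction m)
  case (Suc m)
  have "T (x (Suc (n + m))) = x (n + m)" using assms by (simp add: tent_core_def inverse_limit_def)
  then show ?case using Suc by (simp add: funpow_Suc_right del: funpow.simps)
qed simp

lemma core_range: "x \<in> tent_core s \<Longrightarrow> x n \<in> {lo..hi}"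
  by (simp add: tent_core_def inverse_limit_def lo_def hi_def)

lemma tent_core_iff:
  "x \<in> tent_core s \<longleftrightarrow> (\<forall>n. x n \<in> {lo..hi}) \<and> (\<forall>n. T (x (Suc n)) = x n)"
  by (simp add: tent_core_def inverse_limit_def lo_def hi_def)

text \<open>
  A path whose coordinates stayed long would, by local eventual ontoness, have short subpaths
  whose zeroth coordinate covers the whole core interval, against uniform continuity.
\<close>

lemma path_coordinates_shrink:
  assumes "path g" "path_image g \<subseteq> tent_core s" "0 < e"
  obtains M where "\<And>m t t'. M \<le> m \<Longrightarrow> t \<in> {0..1} \<Longrightarrow> t' \<in> {0..1} \<Longrightarrow> \<bar>g t m - g t' m\<bar> < e"
proof -
  have cont: "continuous_on {0..1} (\<lambda>t. g t m)" for m
    using assms(1) unfolding path_def by (rule continuous_on_product_then_coordinatewise)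
  have core: "g t \<in> tent_core s" if "t \<in> {0..1}" for t
    using that assms(2) by (auto simp: path_image_def)
  have "uniformly_continuous_on {0..1} (\<lambda>t. g t 0)"
    by (intro compact_uniformly_continuous cont) simp
  then obtain d where "0 < d" and d: "\<And>t t'. t \<in> {0..1} \<Longrightarrow> t' \<in> {0..1} \<Longrightarrow> \<bar>t' - t\<bar> < d \<Longrightarrow> \<bar>g t' 0 - g t 0\<bar> < hi - lo"
    using lo_less_hi unfolding uniformly_continuous_on_def dist_real_def
    by (metis diff_gt_0_iff_gt)
  obtain n where n: "1 / real (Suc n) < d" using \<open>0 < d\<close> by (metis nat_approx_posE)
  let ?n = "real (Suc n)"
  obtain M where M: "\<And>m x y. M \<le> m \<Longrightarrow> lo \<le> x \<Longrightarrow> y \<le> hi \<Longrightarrow> e / ?n \<le> y - x \<Longrightarrow> {lo..hi} \<subseteq> (T ^^ m) ` {x..y}"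
    using locally_eventually_onto[of "e / ?n"] \<open>0 < e\<close> by auto
  show thesis
  proof (rule that[of M], rule ccontr)
    fix m t t' assume m: "M \<le> m" and t: "t \<in> {0..1::real}" "t' \<in> {0..1}" and "\<not> \<bar>g t m - g t' m\<bar> < e"
    \<comment> \<open>The parameter segment from \<open>t\<close> to \<open>t'\<close> is cut into
      \<open>?n\<close> pieces shorter than \<open>d\<close>; one of them must account for a change
      of at least \<open>e / ?n\<close> in coordinate \<open>m\<close>.\<close>
    define v where "v i = t + (t' - t) * (real i / ?n)" for i
    have v01: "v i \<in> {0..1}" if "i \<le> Suc n" for i
    proof -
      have "t + (t' - t) * c = (1 - c) * t + c * t'" for c :: real by (simp add: algebra_simps)
      then have "v i = (1 - real i / ?n) * t + (real i / ?n) * t'" unfolding v_def .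
      moreover have "0 \<le> real i / ?n" "real i / ?n \<le> 1" using that by auto
      ultimately show ?thesis using t convexD_alt[of "{0..1::real}" t t' "real i / ?n"] by simp
    qed
    have "\<exists>i<Suc n. e / ?n \<le> \<bar>g (v (Suc i)) m - g (v i) m\<bar>"
    proof (rule ccontr)
      assume "\<not> ?thesis"
      then have lt: "\<bar>g (v (Suc i)) m - g (v i) m\<bar> < e / ?n" if "i < Suc n" for i using that by force
      have "g t' m - g t m = (\<Sum>i<Suc n. g (v (Suc i)) m - g (v i) m)"
        by (subst sum_lessThan_telescope) (simp add: v_def)
      then have "\<bar>g t' m - g t m\<bar> \<le> (\<Sum>i<Suc n. \<bar>g (v (Suc i)) m - g (v i) m\<bar>)" by (simp only: sum_abs)
      also have "\<dots> < (\<Sum>i<Suc n. e / ?n)" by (intro sum_strict_mono lt) auto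
      also have "\<dots> = e" by simp
      finally show False using \<open>\<not> \<bar>g t m - g t' m\<bar> < e\<close> by linarith
    qed
    then obtain i where i: "i < Suc n" and big: "e / ?n \<le> \<bar>g (v (Suc i)) m - g (v i) m\<bar>" by blast
    define S where "S = closed_segment (v i) (v (Suc i))"
    have S01: "S \<subseteq> {0..1}" unfolding S_def using v01[of i] v01[of "Suc i"] i by (intro closed_segment_subset) auto
    define J where "J = (\<lambda>t. g t m) ` S"
    have "connected J" unfolding J_def S_def
      by (intro connected_continuous_image continuous_on_subset[OF cont] S01[unfolded S_def]) simp
    define x where "x = min (g (v i) m) (g (v (Suc i)) m)"
    define y where "y = max (g (v i) m) (g (v (Suc i)) m)"
    have "g (v i) m \<in> J" "g (v (Suc i)) m \<in> J" by (auto simp: J_def S_def)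
    then have xyJ: "x \<in> J" "y \<in> J" by (auto simp: x_def y_def min_def max_def)
    then have "{x..y} \<subseteq> J" using \<open>connected J\<close> by (intro connected_contains_Icc)
    moreover have "J \<subseteq> {lo..hi}" unfolding J_def using core core_range S01 by blast
    then have "{lo..hi} \<subseteq> (T ^^ m) ` {x..y}" using m xyJ big by (intro M) (auto simp: x_def y_def)
    ultimately have "{lo..hi} \<subseteq> (T ^^ m) ` J" by blast
    moreover have "(T ^^ m) ` J = (\<lambda>t. g t 0) ` S"
      unfolding J_def image_image using core_iterate[of _ m 0] core S01 by (intro image_cong) auto
    ultimately have "lo \<in> (\<lambda>t. g t 0) ` S" "hi \<in> (\<lambda>t. g t 0) ` S" using lo_less_hi by auto
    then obtain p p' where p: "p \<in> S" "p' \<in> S" "g p 0 = lo" "g p' 0 = hi" by auto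
    have "\<bar>p' - p\<bar> \<le> \<bar>v (Suc i) - v i\<bar>"
      using p unfolding S_def closed_segment_eq_real_ivl by (auto split: if_splits)
    also have "v (Suc i) - v i = (t' - t) * (real (Suc i) / ?n - real i / ?n)"
      unfolding v_def right_diff_distrib by simp
    also have "real (Suc i) / ?n - real i / ?n = 1 / ?n" by (simp add: diff_divide_distrib[symmetric])
    also have "\<bar>(t' - t) * (1 / ?n)\<bar> = \<bar>t' - t\<bar> * (1 / ?n)" by (simp add: abs_mult)
    also have "\<dots> \<le> 1 * (1 / ?n)" using t by (intro mult_right_mono) auto
    finally have "\<bar>p' - p\<bar> < d" using n by simp
    then have "\<bar>g p' 0 - g p 0\<bar> < hi - lo" using p S01 by (intro d) auto
    then show False using p by simp
  qed
qed

section \<open>Full branches and the arc-components of their fixed points\<close>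

text \<open>\<open>A\<close> is the left end of the interval. Prescribing the affine inverse branch
  says at once that \<open>T ^^ N\<close> is affine, increasing and onto the core interval there.
  The strict inequalities make the fixed point interior to the branch.\<close>

definition full_branch :: "nat \<Rightarrow> real \<Rightarrow> bool" where
  "full_branch N A \<longleftrightarrow> lo < A \<and> A + (hi - lo) / s ^ N < hi \<and>
    (\<forall>y\<in>{lo..hi}. (T ^^ N) (A + (y - lo) / s ^ N) = y)"

section \<open>Inverse branches of the tent map\<close>

lemma right_preimage:
  assumes "y \<in> {lo..hi}"
  shows "1 - y / s \<in> {1/2..hi}" "T (1 - y / s) = y"
proof -
  have "y / s \<le> 1/2" "1 - s/2 \<le> y / s"
    using assms s_gt_1 by (auto simp: lo_eq hi_eq field_simps)
  then show "1 - y / s \<in> {1/2..hi}" by (simp add: hi_eq)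
  then show "T (1 - y / s) = y" using s_gt_1 by (simp add: T_right)
qed

text \<open>The fixed point of \<open>T\<close> on the decreasing lap, the solution of
  \<open>x = s * (1 - x)\<close>.\<close>

definition fixpt :: real where "fixpt = s / (1 + s)"

text \<open>The inverse branch of \<open>T ^^ (2 * k)\<close> that takes the right preimage at every
  step, a contraction towards the fixed point. The even number of steps keeps it increasing.\<close>

definition right_branch :: "nat \<Rightarrow> real \<Rightarrow> real" where
  "right_branch k y = fixpt + (y - fixpt) / s ^ (2 * k)"

lemma right_branch_0 [simp]: "right_branch 0 y = y"
  by (simp add: right_branch_def)

lemma right_branch_Suc: "right_branch (Suc k) y = 1 - (1 - right_branch k y / s) / s"
proof -
  have "1 + s \<noteq> 0" "s \<noteq> 0" using s_gt_1 by auto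
  then have "1 - 1 / s + fixpt / (s * s) = fixpt"
    by (simp add: fixpt_def divide_simps) (simp add: algebra_simps)
  then have "1 - (1 - (fixpt + z) / s) / s = fixpt + z / (s * s)" for z
    by (simp add: diff_divide_distrib add_divide_distrib)
  from this[of "(y - fixpt) / s ^ (2 * k)"] show ?thesis by (simp add: right_branch_def algebra_simps)
qed

lemma right_branch:
  assumes "y \<in> {lo..hi}"
  shows "right_branch k y \<in> {lo..hi}" "(T ^^ (2 * k)) (right_branch k y) = y"
proof -
  have "right_branch k y \<in> {lo..hi} \<and> (T ^^ (2 * k)) (right_branch k y) = y"
  proof (induction k)
    case (Suc k)
    define z where "z = 1 - right_branch k y / s"
    have z: "z \<in> {lo..hi}" "T z = right_branch k y"
      using right_preimage[of "right_branch k y"] Suc lo_less by (auto simp: z_def)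
    have "1 - z / s \<in> {lo..hi}" "T (1 - z / s) = z"
      using right_preimage[OF z(1)] lo_less by auto
    then show ?case
      using Suc z(2) unfolding right_branch_Suc z_def[symmetric]
      by (simp add: funpow_Suc_right del: funpow.simps)
  qed (use assms in auto)
  then show "right_branch k y \<in> {lo..hi}" "(T ^^ (2 * k)) (right_branch k y) = y" by auto
qed

lemma right_branch_range:
  assumes "y \<in> {lo..hi}" "0 < k"
  shows "1/2 \<le> right_branch k y" "right_branch k y < hi"
proof -
  obtain j where k: "k = Suc j" using assms(2) gr0_conv_Suc by blast
  define z where "z = 1 - right_branch j y / s"
  have z: "z \<in> {1/2..hi}" using right_preimage[OF right_branch(1)[OF assms(1)]] by (simp add: z_def)
  then show "1/2 \<le> right_branch k y"
    using right_preimage(1)[of z] lo_less unfolding k right_branch_Suc z_def[symmetric] by auto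
  have "0 < (s - 1) * (s - 1)" using s_gt_1 by simp
  then have "1 - (1/2) / s < hi" using s_gt_1 by (simp add: hi_eq field_simps)
  moreover have "(1/2) / s \<le> z / s" using z s_gt_1 by (intro divide_right_mono) auto
  ultimately show "right_branch k y < hi" unfolding k right_branch_Suc z_def[symmetric] by linarith
qed

text \<open>Places the left preimage \<open>fixpt / s\<close> strictly to the right of
  \<open>lo\<close>. It reduces to \<open>(s - 1) * (s * s - 2) > 0\<close>, where
  \<open>s > sqrt 2\<close> enters.\<close>

lemma fixpt_greater: "s * lo < fixpt"
proof -
  have "0 < s * ((s - 1) * (s * s - 2))" using s_gt_1 s_square by simp
  moreover have "s - s * lo * (1 + s) = s * ((s - 1) * (s * s - 2)) / 2" by (simp add: lo_eq field_simps)
  ultimately have "s * lo * (1 + s) < s" by linarith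
  then show ?thesis using s_gt_1 by (simp add: fixpt_def pos_less_divide_eq)
qed

text \<open>
  With \<open>w\<close> the left preimage of a power of the right branch that is close to the fixed point, \<open>w \<circ> w\<close>
  and a power of the right branch have the same length and orientation.
\<close>

lemma full_branches_exist:
  obtains N A C where "full_branch N A" "full_branch N C" "A + (hi - lo) / s ^ N \<le> C"
proof -
  have "0 < fixpt - s * lo" using fixpt_greater by simp
  moreover have "1 < s * s" using s_square by simp
  \<comment> \<open>The aim is \<open>right_branch k lo > s * lo\<close>: the deviation
    \<open>fixpt - lo\<close> has to shrink below \<open>fixpt - s * lo\<close>.\<close>
  ultimately obtain k0 where k0: "(fixpt - lo) / (fixpt - s * lo) < (s * s) ^ k0"
    using real_arch_pow by blast
  \<comment> \<open>The successor makes \<open>k\<close> positive, as the range of the right branch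
    requires.\<close>
  define k where "k = Suc k0"
  have "(s * s) ^ k0 \<le> s ^ (2 * k)"
    using s_gt_1 s_square by (simp add: k_def power_mult power2_eq_square)
  then have "(fixpt - lo) / (fixpt - s * lo) < s ^ (2 * k)" using k0 by linarith
  then have k_low: "s * lo < right_branch k lo"
    using \<open>0 < fixpt - s * lo\<close> s_gt_1 by (simp add: right_branch_def field_simps)
  have mono: "right_branch k lo \<le> right_branch k y" if "lo \<le> y" for y
    using that s_gt_1 by (simp add: right_branch_def divide_right_mono)
  define w where "w y = right_branch k y / s" for y
  have w: "lo < w y" "w y < 1/2" "(T ^^ Suc (2 * k)) (w y) = y" if "y \<in> {lo..hi}" for y
  proof -
    have "s * lo < right_branch k y" using k_low mono[of y] that by auto
    then show "lo < w y" using s_gt_1 by (simp add: w_def field_simps)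
    have "right_branch k y < s / 2" using right_branch_range[OF that, of k] by (simp add: k_def hi_eq)
    then show half: "w y < 1/2" using s_gt_1 by (simp add: w_def field_simps)
    then have "T (w y) = right_branch k y" using s_gt_1 by (simp add: T_left w_def)
    then show "(T ^^ Suc (2 * k)) (w y) = y"
      using right_branch(2)[OF that, of k] by (simp add: funpow_Suc_right del: funpow.simps)
  qed
  have w_core: "w y \<in> {lo..hi}" if "y \<in> {lo..hi}" for y
    using w[OF that] hi_greater by auto
  \<comment> \<open>The exponent of \<open>w\<close> alone is odd. Doubling it lets a right branch,
    defined for even exponents only, share the same \<open>N\<close>.\<close>
  define N where "N = Suc (2 * k) + Suc (2 * k)"
  have sN: "s ^ N = s * s ^ (2 * k) * (s * s ^ (2 * k))" by (simp only: N_def power_add power_Suc)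
  have w_affine: "w y = w lo + (y - lo) / (s * s ^ (2 * k))" for y
    using s_gt_1 by (simp add: w_def right_branch_def field_simps)
  have ww_affine: "w (w y) = w (w lo) + (y - lo) / s ^ N" for y
  proof -
    let ?D = "s * s ^ (2 * k)"
    have "w (w y) - w (w lo) = (w y - w lo) / ?D"
      using w_affine[of "w y"] w_affine[of "w lo"] unfolding diff_divide_distrib by linarith
    also have "w y - w lo = (y - lo) / ?D" using w_affine[of y] by simp
    finally show ?thesis unfolding sN divide_divide_eq_left by linarith
  qed
  have ends: "lo \<in> {lo..hi}" "hi \<in> {lo..hi}" using lo_less_hi by auto
  have fullA: "full_branch N (w (w lo))"
    unfolding full_branch_def
  proof (intro conjI ballI)
    show "lo < w (w lo)" using w(1) w_core ends by blast
    show "w (w lo) + (hi - lo) / s ^ N < hi"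
      using w(2)[OF w_core[OF ends(2)]] hi_greater ww_affine[of hi] by linarith
    fix y assume y: "y \<in> {lo..hi}"
    have "(T ^^ N) (w (w y)) = y"
      unfolding N_def funpow_add comp_def w(3)[OF w_core[OF y]] by (rule w(3)[OF y])
    then show "(T ^^ N) (w (w lo) + (y - lo) / s ^ N) = y" by (simp only: ww_affine[symmetric])
  qed
  have N: "N = 2 * Suc (2 * k)" by (simp add: N_def)
  define C where "C = right_branch (Suc (2 * k)) lo"
  have C_affine: "C + (y - lo) / s ^ N = right_branch (Suc (2 * k)) y" for y
    unfolding N C_def right_branch_def by (simp add: diff_divide_distrib)
  have C: "1/2 \<le> C" using right_branch_range(1)[OF ends(1), of "Suc (2 * k)"] by (simp add: C_def)
  have fullC: "full_branch N C"
    unfolding full_branch_def C_affine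
    using right_branch_range(2)[OF ends(2), of "Suc (2 * k)"] right_branch(2)[of _ "Suc (2 * k)"] C lo_less
    by (auto simp only: N)
  show thesis
    using w(2)[OF w_core[OF ends(2)]] C ww_affine[of hi]
    by (intro that[OF fullA fullC]) linarith
qed

end

section \<open>The fixed point of a branch and the arc-component of its orbit\<close>

locale tent_branch = tent_map +
  fixes N :: nat and A :: real
  assumes full: "full_branch N A"
begin

abbreviation width :: real where "width \<equiv> (hi - lo) / s ^ N"

lemma A_greater: "lo < A" and A_end: "A + width < hi"
  and branch_inverse: "y \<in> {lo..hi} \<Longrightarrow> (T ^^ N) (A + (y - lo) / s ^ N) = y"
  using full by (auto simp: full_branch_def)

lemma slope_gt_1: "1 < s ^ N"
proof -
  have "(hi - lo) / s ^ N < hi - lo" using A_greater A_end by linarith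
  then have "(hi - lo) * 1 < (hi - lo) * s ^ N" using s_gt_1 by (simp add: pos_divide_less_eq)
  then show ?thesis using lo_less_hi by (simp only: mult_less_cancel_left_pos diff_gt_0_iff_gt)
qed

lemma slope_width: "s ^ N * width = hi - lo"
  using s_gt_1 by simp

lemma N_pos: "0 < N"
  using slope_gt_1 by (cases N) auto

lemma branch_affine:
  assumes "x \<in> {A..A + width}"
  shows "(T ^^ N) x = lo + s ^ N * (x - A)"
proof -
  have "0 \<le> s ^ N * (x - A)" using assms s_gt_1 by simp
  moreover have "s ^ N * (x - A) \<le> s ^ N * width" using assms s_gt_1 by (intro mult_left_mono) auto
  ultimately have "lo + s ^ N * (x - A) \<in> {lo..hi}" unfolding slope_width by auto
  from branch_inverse[OF this] show ?thesis using s_gt_1 by simp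
qed

text \<open>The solution of \<open>lo + s ^ N * (p - A) = p\<close>, hence the fixed point of
  \<open>T ^^ N\<close> in the branch.\<close>

definition p :: real where "p = (s ^ N * A - lo) / (s ^ N - 1)"

lemma p_eq: "p = A + (p - lo) / s ^ N"
  using slope_gt_1 s_gt_1 by (simp add: p_def field_simps)

lemma p_interior: "A < p" "p < A + width"
proof -
  have "(s ^ N - 1) * A < s ^ N * A - lo" using A_greater by (simp add: algebra_simps)
  then show "A < p" using slope_gt_1 by (simp add: p_def field_simps)
  have "(s ^ N - 1) * (A + w) = s ^ N * A + s ^ N * w - (A + w)" for w by (simp add: algebra_simps)
  from this[of width] have "s ^ N * A - lo < (s ^ N - 1) * (A + width)"
    using A_end unfolding slope_width by linarith
  then show "p < A + width" using slope_gt_1 unfolding p_def by (simp add: pos_divide_less_eq mult.commute)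
qed

lemma p_core: "p \<in> {lo..hi}"
  using p_interior A_greater A_end by auto

lemma contraction_core:
  assumes "t \<in> {lo..hi}"
  shows "p + (t - p) / s ^ i \<in> {lo..hi}"
proof -
  define c where "c = 1 / s ^ i"
  have c: "0 \<le> c" "c \<le> 1" using s_gt_1 by (auto simp: c_def one_le_power)
  have "p + (t - p) / s ^ i = (1 - c) * p + c * t"
    by (simp add: c_def left_diff_distrib diff_divide_distrib)
  then show ?thesis using convexD_alt[of "{lo..hi}" p t c] c assms p_core by simp
qed

lemma section_p:
  assumes "p + e \<in> {lo..hi}"
  shows "(T ^^ N) (p + e / s ^ N) = p + e"
proof -
  have "p + e / s ^ N = A + (p + e - lo) / s ^ N"
    using p_eq by (simp add: diff_divide_distrib add_divide_distrib)
  then show ?thesis using branch_inverse[OF assms] by simp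
qed

lemma sections_p:
  assumes "t \<in> {lo..hi}"
  shows "(T ^^ (k * N)) (p + (t - p) / s ^ (k * N)) = t"
proof (induction k)
  case (Suc k)
  have "(T ^^ N) (p + (t - p) / s ^ (k * N) / s ^ N) = p + (t - p) / s ^ (k * N)"
    using contraction_core[OF assms] by (rule section_p)
  then show ?case using Suc by (simp add: add.commute[of N] power_add funpow_add mult.commute)
qed simp

text \<open>
  The backward orbit with coordinate \<open>t\<close> at index \<open>j * N\<close> that from there on stays in the branch.
  The number of iterates is just some multiple of \<open>N\<close>, minus \<open>i\<close>, that is large enough.
\<close>

definition thread :: "nat \<Rightarrow> real \<Rightarrow> nat \<Rightarrow> real" where
  "thread j t i = (T ^^ ((i + j) * N - i)) (p + (t - p) / s ^ (i * N))"

text \<open>Keeps the subtraction of natural numbers in \<open>thread\<close> exact.\<close>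

lemma index_le: "i \<le> (i + j) * N"
  using N_pos by (metis One_nat_def Suc_leI le_add1 mult.right_neutral mult_le_mono)

lemma thread_core:
  assumes "t \<in> {lo..hi}"
  shows "thread j t \<in> tent_core s"
  unfolding tent_core_iff
proof (intro conjI allI)
  show "thread j t i \<in> {lo..hi}" for i
    unfolding thread_def by (intro iterate_core contraction_core assms)
  fix i
  \<comment> \<open>Passing to the next index divides the offset from \<open>p\<close> once more by
    \<open>s ^ N\<close> and adds \<open>N - 1\<close> iterates. With the extra \<open>T\<close>
    that makes \<open>N\<close>, which cancels the division.\<close>
  have "Suc ((Suc i + j) * N - Suc i) = ((i + j) * N - i) + N"
    using index_le[of i j] index_le[of "Suc i" j] by simp
  then have "T (thread j t (Suc i)) = (T ^^ (((i + j) * N - i) + N)) (p + (t - p) / s ^ (i * N) / s ^ N)"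
    unfolding thread_def by (simp add: power_add mult.commute flip: funpow.simps(2)[THEN fun_cong, unfolded comp_def])
  also have "\<dots> = thread j t i"
    using section_p[OF contraction_core[OF assms, of "i * N"]] by (simp add: funpow_add thread_def)
  finally show "T (thread j t (Suc i)) = thread j t i" .
qed

lemma thread_at:
  assumes "t \<in> {lo..hi}"
  shows "thread j t (j * N) = t"
proof -
  have "(j * N + j) * N - j * N = (j * N) * N" by (simp add: algebra_simps)
  then show ?thesis using sections_p[OF assms, of "j * N"] by (simp add: thread_def)
qed

definition base :: "nat \<Rightarrow> real" where "base = thread 0 p"

lemma iterate_p: "(T ^^ (k * N)) p = p"
  using sections_p[OF p_core, of k] by simp

text \<open>The surplus \<open>j * N\<close> iterates fix \<open>p\<close>. So the arcs
  \<open>t \<mapsto> thread j t\<close> pass through one common point, whatever \<open>j\<close>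
  is.\<close>

lemma thread_p: "thread j p = base"
proof
  fix i
  have "(i + j) * N - i = (i * N - i) + j * N"
    using index_le[of i 0] by (simp add: algebra_simps)
  then show "thread j p i = base i"
    using iterate_p[of j] by (simp add: base_def thread_def funpow_add)
qed

lemma base_core: "base \<in> tent_core s"
  unfolding base_def by (rule thread_core[OF p_core])

lemma base_at: "base (k * N) = p"
  using thread_at[OF p_core, of k] by (simp add: thread_p)

lemma thread_in_component:
  assumes "t \<in> {lo..hi}"
  shows "thread j t \<in> arc_component (tent_core s) base"
proof -
  define g where "g r = thread j (lo + (hi - lo) * r)" for r
  have range: "lo + (hi - lo) * r \<in> {lo..hi} \<longleftrightarrow> r \<in> {0..1}" for r
    using lo_less_hi by (auto simp: zero_le_mult_iff) (smt (verit) mult_le_cancel_left1 mult_le_cancel_left2)+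
  have img: "thread j u \<in> path_image g" if "u \<in> {lo..hi}" for u
  proof -
    have "u = lo + (hi - lo) * ((u - lo) / (hi - lo))" using lo_less_hi by simp
    then show ?thesis unfolding path_image_def g_def using range that by (metis imageI)
  qed
  have "arc g"
    unfolding arc_def path_def
  proof
    show "continuous_on {0..1} g"
      unfolding g_def thread_def
      by (intro continuous_on_coordinatewise_then_product continuous_on_compose2[OF continuous_iterate[of UNIV]]
          continuous_intros) (use s_gt_1 in auto)
    show "inj_on g {0..1}"
    proof (rule inj_onI)
      fix r r' :: real assume r: "r \<in> {0..1}" "r' \<in> {0..1}" and "g r = g r'"
      then have "g r (j * N) = g r' (j * N)" by simp
      then have "lo + (hi - lo) * r = lo + (hi - lo) * r'"
        unfolding g_def using r by (simp only: thread_at range)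
      then show "r = r'" using lo_less_hi by simp
    qed
  qed
  moreover have "path_image g \<subseteq> tent_core s"
    unfolding path_image_def g_def using thread_core range by blast
  moreover have "base \<in> path_image g" using img[OF p_core] by (simp add: thread_p)
  ultimately show ?thesis using img[OF assms] unfolding arc_component_def by blast
qed

lemma component_nondegenerate: "nondegenerate (arc_component (tent_core s) base)"
  unfolding nondegenerate_def
proof
  assume "\<exists>a. arc_component (tent_core s) base = {a}"
  moreover have "thread 0 lo \<in> arc_component (tent_core s) base" "thread 0 hi \<in> arc_component (tent_core s) base"
    using lo_less_hi by (auto intro: thread_in_component)
  ultimately have "thread 0 lo 0 = thread 0 hi 0" by auto
  then show False using thread_at[of lo 0] thread_at[of hi 0] lo_less_hi by auto
qed

lemma component_dense: "dense_subset (tent_core s) (arc_component (tent_core s) base)"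
  unfolding dense_subset_def
proof
  show "arc_component (tent_core s) base \<subseteq> tent_core s"
    using base_core by (auto simp: arc_component_def)
  show "tent_core s \<subseteq> closure (arc_component (tent_core s) base)"
  proof
    fix x assume x: "x \<in> tent_core s"
    have "\<exists>y\<in>arc_component (tent_core s) base. \<forall>i\<le>n. y i = x i" for n
    proof -
      have "n \<le> n * N" using index_le[of n 0] by simp
      \<comment> \<open>As \<open>T\<close> maps the core interval onto itself, \<open>x n\<close>
        has a preimage \<open>t\<close> to be placed at index \<open>n * N\<close> of a thread. The
        coordinates up to index \<open>n\<close> then agree automatically.\<close>
      have "x n \<in> (T ^^ (n * N - n)) ` {lo..hi}"
        using core_range[OF x, of n] iterate_onto_mono[of 0 "{lo..hi}" "n * N - n"] by auto
      then obtain t where t: "t \<in> {lo..hi}" "x n = (T ^^ (n * N - n)) t" by auto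
      have "thread n t n = x n"
        using core_iterate[OF thread_core[OF t(1)], of "n * N - n" n n] thread_at[OF t(1), of n] t(2) \<open>n \<le> n * N\<close>
        by simp
      moreover have "y i = (T ^^ (n - i)) (y n)" if "y \<in> tent_core s" "i \<le> n" for y i
        using core_iterate[OF that(1), of "n - i" i] that(2) by simp
      ultimately have "\<forall>i\<le>n. thread n t i = x i" using x thread_core[OF t(1)] by metis
      then show ?thesis using thread_in_component[OF t(1)] by blast
    qed
    then obtain y where y: "\<And>n. y n \<in> arc_component (tent_core s) base" "\<And>n i. i \<le> n \<Longrightarrow> y n i = x i"
      by metis
    have "(\<lambda>n. y n i) \<longlonglongrightarrow> x i" for i
      by (rule tendsto_eventually) (use y(2) in \<open>auto simp: eventually_sequentially\<close>)
    then have "limitin (product_topology (\<lambda>_. euclidean) UNIV) y x sequentially"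
      by (simp add: limitin_componentwise)
    then have "y \<longlonglongrightarrow> x" by (simp flip: limitin_canonical_iff add: euclidean_product_topology)
    then show "x \<in> closure (arc_component (tent_core s) base)"
      using y(1) closure_sequential by blast
  qed
qed

text \<open>On an arc through \<open>base\<close> and \<open>y\<close> the lengths of the
  coordinates tend to zero, and the coordinates of \<open>base\<close> at multiples of
  \<open>N\<close> all equal \<open>p\<close>.\<close>

lemma component_tail:
  assumes "y \<in> arc_component (tent_core s) base" "0 < e"
  obtains M where "\<And>k. M \<le> k \<Longrightarrow> \<bar>y (k * N) - p\<bar> < e"
proof (cases "y = base")
  case True
  then show thesis using that[of 0] base_at assms(2) by simp
next
  case False
  then obtain g where g: "arc g" "path_image g \<subseteq> tent_core s" "base \<in> path_image g" "y \<in> path_image g"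
    using assms(1) by (auto simp: arc_component_def)
  obtain M where M: "\<And>m t t'. M \<le> m \<Longrightarrow> t \<in> {0..1} \<Longrightarrow> t' \<in> {0..1} \<Longrightarrow> \<bar>g t m - g t' m\<bar> < e"
    using path_coordinates_shrink[OF arc_imp_path[OF g(1)] g(2) assms(2)] by metis
  have "\<bar>y (k * N) - p\<bar> < e" if "M \<le> k" for k
  proof -
    have "M \<le> k * N" using order_trans[OF that index_le[of k 0]] by simp
    then have "\<bar>y (k * N) - base (k * N)\<bar> < e" using M g(3,4) by (auto simp: path_image_def)
    then show ?thesis by (simp add: base_at)
  qed
  then show thesis by (rule that)
qed

end

section \<open>The planar embedding\<close>

lemma arc_component_image_subset:
  assumes "continuous_on X h" "inj_on h X"
  shows "h ` arc_component X x \<subseteq> arc_component (h ` X) (h x)"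
proof
  fix z assume "z \<in> h ` arc_component X x"
  then consider "z = h x" | g where "arc g" "path_image g \<subseteq> X" "x \<in> path_image g" "z \<in> h ` path_image g"
    by (auto simp: arc_component_def)
  then show "z \<in> arc_component (h ` X) (h x)"
  proof cases
    case 2
    have "arc (h \<circ> g)"
      using 2(1,2) assms unfolding arc_def path_def path_image_def
      by (auto intro: continuous_on_compose[unfolded comp_def] continuous_on_subset comp_inj_on inj_on_subset)
    moreover have "path_image (h \<circ> g) = h ` path_image g" by (simp add: path_image_compose)
    ultimately show ?thesis using 2 unfolding arc_component_def
      by (intro insertI2 UnionI[of "h ` path_image g"]) (auto intro!: exI[of _ "h \<circ> g"])
  qed (simp add: arc_component_def)
qed

lemma arc_component_homeomorphic_image:
  assumes "homeomorphism X Y h k" "x \<in> X"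
  shows "arc_component Y (h x) = h ` arc_component X x"
proof
  have Y: "h ` X = Y" "k ` Y = X" and kh: "\<And>x. x \<in> X \<Longrightarrow> k (h x) = x" and hk: "\<And>y. y \<in> Y \<Longrightarrow> h (k y) = y"
    using assms(1) by (auto simp: homeomorphism_def)
  have "inj_on h X" "inj_on k Y" using kh hk by (auto intro: inj_on_inverseI)
  then have sub: "h ` arc_component X x \<subseteq> arc_component Y (h x)"
      "k ` arc_component Y (h x) \<subseteq> arc_component X x"
    using assms kh arc_component_image_subset[of X h x] arc_component_image_subset[of Y k "h x"] Y
    by (auto simp: homeomorphism_def)
  have "arc_component Y (h x) \<subseteq> Y" using assms(2) Y(1) by (auto simp: arc_component_def)
  show "arc_component Y (h x) \<subseteq> h ` arc_component X x"
  proof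
    fix y assume y: "y \<in> arc_component Y (h x)"
    then have "h (k y) = y" "k y \<in> arc_component X x"
      using sub(2) \<open>arc_component Y (h x) \<subseteq> Y\<close> hk by blast+
    then show "y \<in> h ` arc_component X x" by (metis imageI)
  qed
  show "h ` arc_component X x \<subseteq> arc_component Y (h x)" by (rule sub)
qed

lemma clamp_nonexpansive:
  fixes a b x y :: real
  shows "\<bar>max a x - max a y\<bar> \<le> \<bar>x - y\<bar>" "\<bar>min b x - min b y\<bar> \<le> \<bar>x - y\<bar>"
  by (auto simp: max_def min_def)

section \<open>Factorization of the iterate through a fold\<close>

locale two_branches =
  left: tent_branch s N A + right: tent_branch s N C for s N A C +
  assumes disjoint: "A + (left.hi - left.lo) / s ^ N \<le> C"
begin

abbreviation "lo \<equiv> left.lo"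
abbreviation "hi \<equiv> left.hi"
abbreviation "T \<equiv> tent s"
abbreviation B :: real where "B \<equiv> A + (hi - lo) / s ^ N"
abbreviation D :: real where "D \<equiv> C + (hi - lo) / s ^ N"

text \<open>The three variable terms belong to \<open>[lo, A]\<close>, \<open>[A, D]\<close> and
  \<open>[D, hi]\<close>. Each is constant off its own interval, and they fit together because
  \<open>T ^^ N\<close> takes \<open>A\<close> to \<open>lo\<close> and \<open>D\<close> to
  \<open>hi\<close>. The outer clamp extends the map to the whole line.\<close>

definition retract :: "real \<Rightarrow> real" where
  "retract x = (let y = max lo (min hi x) in
    A + ((T ^^ N) (min y A) - lo) / s ^ N + (max A (min D y) - A) + ((T ^^ N) (max y D) - hi) / s ^ N)"

definition stretch :: "real \<Rightarrow> real" where
  "stretch x = (T ^^ N) (max A (min D x))"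

lemma order: "lo < A" "A < B" "B \<le> C" "C < D" "D < hi" "0 \<le> lo" "hi \<le> 1"
  using left.A_greater left.p_interior right.p_interior right.A_end disjoint left.lo_nonneg left.hi_le_1
  by linarith+

lemma slope: "1 < s ^ N"
  by (rule left.slope_gt_1)

lemma iterate_ends: "(T ^^ N) A = lo" "(T ^^ N) B = hi" "(T ^^ N) C = lo" "(T ^^ N) D = hi"
  using left.branch_affine[of A] left.branch_affine[of B] right.branch_affine[of C] right.branch_affine[of D]
    order left.slope_width by auto

lemma retract_left:
  assumes "x \<le> A"
  shows "retract x = A + ((T ^^ N) (max lo x) - lo) / s ^ N"
  using assms order iterate_ends by (auto simp: retract_def Let_def max_def min_def)

lemma retract_middle:
  assumes "x \<in> {A..D}"
  shows "retract x = x"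
  using assms order iterate_ends by (auto simp: retract_def Let_def max_def min_def)

lemma retract_right:
  assumes "D \<le> x"
  shows "retract x = C + ((T ^^ N) (min hi x) - lo) / s ^ N"
proof -
  have "retract x = D + ((T ^^ N) (min hi x) - hi) / s ^ N"
    using assms order iterate_ends by (auto simp: retract_def Let_def max_def min_def)
  then show ?thesis by (simp add: diff_divide_distrib)
qed

lemma scaled_range:
  assumes "y \<in> {lo..hi}"
  shows "0 \<le> (y - lo) / s ^ N" "(y - lo) / s ^ N \<le> (hi - lo) / s ^ N"
  using assms slope by (auto intro!: divide_right_mono)

lemma retract_left_range:
  assumes "x \<le> A"
  shows "A \<le> retract x" "retract x \<le> B"
  using scaled_range[OF left.iterate_core[of "max lo x" N]] assms order
  by (auto simp: retract_left)

lemma retract_right_range: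
  assumes "D \<le> x"
  shows "C \<le> retract x" "retract x \<le> D"
  using scaled_range[OF left.iterate_core[of "min hi x" N]] assms order
  by (auto simp: retract_right)

lemma retract_range: "retract x \<in> {A..D}"
  using retract_left_range[of x] retract_right_range[of x] retract_middle[of x] order
  by (cases "x \<le> A"; cases "D \<le> x") auto

text \<open>Outside the hull \<open>retract\<close> applies an inverse branch after
  \<open>T ^^ N\<close>, and the \<open>T ^^ N\<close> in \<open>stretch\<close> cancels that
  branch.\<close>

lemma stretch_retract:
  assumes "x \<in> {lo..hi}"
  shows "stretch (retract x) = (T ^^ N) x"
proof -
  have "stretch (retract x) = (T ^^ N) (retract x)"
    using retract_range[of x] by (simp add: stretch_def max_absorb2 min_absorb2)
  also have "\<dots> = (T ^^ N) x"
  proof -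
    consider "x \<le> A" | "x \<in> {A..D}" | "D \<le> x" by fastforce
    then show ?thesis
    proof cases
      case 1
      then have "retract x = A + ((T ^^ N) x - lo) / s ^ N" using assms by (simp add: retract_left max_absorb2)
      then show ?thesis using left.branch_inverse[OF left.iterate_core[OF assms]] by simp
    next
      case 3
      then have "retract x = C + ((T ^^ N) x - lo) / s ^ N" using assms by (simp add: retract_right min_absorb2)
      then show ?thesis using right.branch_inverse[OF left.iterate_core[OF assms]] by simp
    qed (simp add: retract_middle)
  qed
  finally show ?thesis .
qed

lemma stretch_lipschitz: "\<bar>stretch x - stretch y\<bar> \<le> 3 * s ^ N * \<bar>x - y\<bar>"
proof -
  have "\<bar>stretch x - stretch y\<bar> \<le> s ^ N * \<bar>max A (min D x) - max A (min D y)\<bar>"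
    unfolding stretch_def by (rule left.iterate_lipschitz)
  also have "\<dots> \<le> s ^ N * \<bar>x - y\<bar>"
    using slope order_trans[OF clamp_nonexpansive(1) clamp_nonexpansive(2)] by (intro mult_left_mono) auto
  also have "\<dots> \<le> 3 * s ^ N * \<bar>x - y\<bar>" using slope by (intro mult_right_mono) auto
  finally show ?thesis .
qed

text \<open>Division by \<open>s ^ N\<close> cancels the slope of \<open>T ^^ N\<close>, so each of
  the three terms is nonexpansive. The weaker constant is the one shared with
  \<open>stretch\<close>.\<close>

lemma retract_lipschitz: "\<bar>retract x - retract y\<bar> \<le> 3 * s ^ N * \<bar>x - y\<bar>"
proof -
  have scaled: "\<bar>((T ^^ N) u - k) / s ^ N - ((T ^^ N) v - k) / s ^ N\<bar> \<le> \<bar>x - y\<bar>"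
    if "\<bar>u - v\<bar> \<le> \<bar>x - y\<bar>" for u v k
  proof -
    have "\<bar>((T ^^ N) u - k) / s ^ N - ((T ^^ N) v - k) / s ^ N\<bar> = \<bar>(T ^^ N) u - (T ^^ N) v\<bar> / s ^ N"
      using slope by (simp add: diff_divide_distrib[symmetric])
    also have "\<dots> \<le> \<bar>u - v\<bar>"
      using left.iterate_lipschitz[of N u v] slope by (simp add: pos_divide_le_eq mult.commute)
    finally show ?thesis using that by linarith
  qed
  define u where "u = max lo (min hi x)"
  define v where "v = max lo (min hi y)"
  have uv: "\<bar>u - v\<bar> \<le> \<bar>x - y\<bar>"
    unfolding u_def v_def by (rule order_trans[OF clamp_nonexpansive(1) clamp_nonexpansive(2)])
  have mM: "\<bar>min u A - min v A\<bar> \<le> \<bar>x - y\<bar>" "\<bar>max u D - max v D\<bar> \<le> \<bar>x - y\<bar>"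
    using order_trans[OF clamp_nonexpansive(2) uv] order_trans[OF clamp_nonexpansive(1) uv]
    by (simp_all only: min.commute[of _ A] max.commute[of _ D])
  define f where "f w = ((T ^^ N) (min w A) - lo) / s ^ N" for w
  define g where "g w = max A (min D w)" for w
  define h where "h w = ((T ^^ N) (max w D) - hi) / s ^ N" for w
  have f: "\<bar>f u - f v\<bar> \<le> \<bar>x - y\<bar>" unfolding f_def by (rule scaled[OF mM(1)])
  have h: "\<bar>h u - h v\<bar> \<le> \<bar>x - y\<bar>" unfolding h_def by (rule scaled[OF mM(2)])
  have g: "\<bar>g u - g v\<bar> \<le> \<bar>x - y\<bar>"
    unfolding g_def by (rule order_trans[OF order_trans[OF clamp_nonexpansive(1) clamp_nonexpansive(2)] uv])
  have "retract x = A + f u + (g u - A) + h u" "retract y = A + f v + (g v - A) + h v"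
    by (simp_all only: retract_def Let_def u_def v_def f_def g_def h_def)
  then have "retract x - retract y = (f u - f v) + (g u - g v) + (h u - h v)" by simp
  also have "\<bar>(f u - f v) + (g u - g v) + (h u - h v)\<bar> \<le> \<bar>x - y\<bar> + \<bar>x - y\<bar> + \<bar>x - y\<bar>"
    by (intro order_trans[OF abs_triangle_ineq] add_mono f g h)
  also have "\<dots> = 3 * \<bar>x - y\<bar>" by simp
  also have "\<dots> \<le> 3 * s ^ N * \<bar>x - y\<bar>" using slope by (intro mult_right_mono) auto
  finally show ?thesis .
qed

sublocale lozi_scheme "\<lambda>k. if even k then stretch else retract" "3 * s ^ N" "1 / (8 * s ^ N)"
proof
  show "1 \<le> 3 * s ^ N" "0 < 1 / (8 * s ^ N)" using slope by auto
  \<comment> \<open>With this \<open>q\<close>, \<open>L * q = 3/8\<close> and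
    \<open>q \<le> 1/8\<close>, which add up to the permitted \<open>1/2\<close>.\<close>
  have "1 / (8 * s ^ N) \<le> 1/8" using slope by (simp add: field_simps)
  moreover have "3 * s ^ N * (1 / (8 * s ^ N)) = 3/8" using left.s_gt_1 by simp
  ultimately show "3 * s ^ N * (1 / (8 * s ^ N)) + 1 / (8 * s ^ N) \<le> 1/2" by linarith
qed (auto intro: stretch_lipschitz retract_lipschitz)

text \<open>
  The interleaved backward orbit of the factorization \<open>T ^^ N = stretch \<circ> retract\<close>.
\<close>

definition code :: "(nat \<Rightarrow> real) \<Rightarrow> nat \<Rightarrow> real" where
  "code x k = (if even k then x (k div 2 * N) else retract (x (Suc k div 2 * N)))"

lemma code_even: "code x (2 * m) = x (m * N)" and code_odd: "code x (Suc (2 * m)) = retract (x (Suc m * N))"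
  by (simp_all add: code_def)

lemma code_orbit:
  assumes x: "x \<in> tent_core s"
  shows "orbit (code x)"
  unfolding orbit_def
proof (intro conjI allI)
  fix k
  have core: "x n \<in> {lo..hi}" for n by (rule left.core_range[OF x])
  show "\<bar>code x k\<bar> \<le> 1"
    using core[of "k div 2 * N"] retract_range[of "x (Suc k div 2 * N)"] order
    by (auto simp: code_def)
  show "(if even k then stretch else retract) (code x (Suc k)) = code x k"
  proof (cases "even k")
    case True
    then obtain m where k: "k = 2 * m" by blast
    have "stretch (retract (x (Suc m * N))) = x (m * N)"
      using stretch_retract[OF core] left.core_iterate[OF x, of N "m * N"] by (simp add: add.commute)
    then show ?thesis by (simp only: k code_odd code_even even_mult_iff) simp
  next
    case False
    then show ?thesis by (simp add: code_def)
  qed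
qed

lemma code_inj:
  assumes "x \<in> tent_core s" "y \<in> tent_core s" "code x = code y"
  shows "x = y"
proof
  fix i
  have "i \<le> i * N" using left.index_le[of i 0] by simp
  moreover have "x (i * N) = y (i * N)" using assms(3) code_even by metis
  ultimately show "x i = y i"
    using left.core_iterate[OF assms(1), of "i * N - i" i] left.core_iterate[OF assms(2), of "i * N - i" i]
    by simp
qed

section \<open>The embedding and accessibility of the two arc-components\<close>

definition embed :: "(nat \<Rightarrow> real) \<Rightarrow> real^2" where
  "embed x = draw (code x)"

lemma continuous_embed: "continuous_on (tent_core s) embed"
proof -
  have coord: "continuous_on S (\<lambda>x. x n)" for S :: "(nat \<Rightarrow> real) set" and n
    by (rule continuous_on_subset[OF continuous_on_product_coordinates]) simp
  have "continuous_on S (\<lambda>x. retract (x n))" for S :: "(nat \<Rightarrow> real) set" and n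
    using continuous_on_compose2[OF continuous_G[of UNIV 1] coord] by simp
  then have "continuous_on (tent_core s) (\<lambda>x. code x k)" for k
    by (cases "even k") (simp_all add: code_def coord)
  then have "continuous_on (tent_core s) (\<lambda>x. soln (code x) k)" for k
    using code_orbit by (intro continuous_soln) auto
  then show ?thesis unfolding embed_def draw_def by (intro continuous_intros)
qed

lemma inj_embed: "inj_on embed (tent_core s)"
proof (rule inj_onI)
  fix x y assume xy: "x \<in> tent_core s" "y \<in> tent_core s" and "embed x = embed y"
  then have "code x = code y"
    using draw_eq_iff[OF code_orbit code_orbit] by (simp add: embed_def)
  with xy show "x = y" by (rule code_inj)
qed

text \<open>Reduces accessibility to one-sided estimates for \<open>stretch\<close> and
  \<open>retract\<close> near \<open>p\<close>. The tail of the code stays within \<open>e\<close>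
  of \<open>p\<close>, and the solution adds less than another \<open>e\<close>, whence the radius
  \<open>2*e\<close>.\<close>

lemma accessible_embed:
  assumes x: "x \<in> tent_core s" and "0 < e" and "{p - 2*e..p + 2*e} \<subseteq> {A..D}"
    and tail: "\<And>k. M \<le> k \<Longrightarrow> \<bar>x (k * N) - p\<bar> < e" and \<sigma>: "\<bar>\<sigma>\<bar> = 1" and "0 < c"
    and stretch: "\<And>y z. \<bar>y - p\<bar> \<le> 2*e \<Longrightarrow> \<bar>z\<bar> \<le> 3 \<Longrightarrow> \<sigma> * (z - y) \<le> 0 \<Longrightarrow>
      \<sigma> * (stretch z - stretch y) \<le> c * (\<sigma> * (z - y))"
    and retract: "\<And>y z. \<bar>y - p\<bar> \<le> 2*e \<Longrightarrow> \<bar>z\<bar> \<le> 3 \<Longrightarrow> 0 \<le> \<sigma> * (z - y) \<Longrightarrow>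
      0 \<le> \<sigma> * (retract z - retract y)"
  shows "accessible (embed ` tent_core s) (embed x)"
proof -
  define q where "q = 1 / (8 * s ^ N)"
  have "\<bar>q\<bar> < 1" using q_pos q_le_half by (simp add: q_def)
  then have "(\<lambda>k. 2 * q ^ k) \<longlonglongrightarrow> 2 * 0" by (intro tendsto_intros LIMSEQ_power_zero) simp
  then have "\<forall>\<^sub>F k in sequentially. 2 * q ^ k < e"
    using \<open>0 < e\<close> by (intro order_tendstoD(2)[where y = "2 * 0"]) auto
  then obtain K where K: "\<And>k. K \<le> k \<Longrightarrow> 2 * q ^ k < e" by (auto simp: eventually_sequentially)
  define i where "i = max K M"
  have code_near: "\<bar>code x k - p\<bar> < e" if "2 * i \<le> k" for k
  proof (cases "even k")
    case True
    then obtain m where k: "k = 2 * m" by blast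
    then show ?thesis using tail[of m] that by (simp add: code_even i_def)
  next
    case False
    then obtain m where k: "k = Suc (2 * m)" by (elim oddE) auto
    have near: "\<bar>x (Suc m * N) - p\<bar> < e" using that k by (intro tail) (auto simp: i_def)
    then have "x (Suc m * N) \<in> {A..D}" using \<open>0 < e\<close> by (intro subsetD[OF assms(3)]) auto
    then show ?thesis using near by (simp only: k code_odd retract_middle)
  qed
  have soln_near': "\<bar>soln (code x) k - p\<bar> \<le> 2 * e" if "2 * i \<le> k" for k
    using soln_near[OF code_orbit[OF x], of k] code_near[OF that] K[of k] that
    unfolding q_def i_def by linarith
  have corner: "z' = code x"
    if z': "z' \<in> code ` tent_core s" and "0 \<le> \<sigma> * (soln z' (2*i) - soln (code x) (2*i))"
      and "\<sigma> * (soln z' (Suc (2*i)) - soln (code x) (Suc (2*i))) \<le> 0" for z'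
  proof (rule corner_imp_eq[where c = c and i = i and \<sigma> = \<sigma>])
    show "orbit (code x)" "orbit z'" using code_orbit x z' by auto
  next
    fix m z assume "i \<le> m" "\<bar>z\<bar> \<le> 3" "\<sigma> * (z - soln (code x) (Suc (2*m))) \<le> 0"
    then show "\<sigma> * ((if even (2*m) then stretch else retract) z
        - (if even (2*m) then stretch else retract) (soln (code x) (Suc (2*m))))
      \<le> c * (\<sigma> * (z - soln (code x) (Suc (2*m))))"
      using stretch[OF soln_near'] by simp
  next
    fix m z assume "i \<le> m" "\<bar>z\<bar> \<le> 3" "0 \<le> \<sigma> * (z - soln (code x) (2 * Suc m))"
    then show "0 \<le> \<sigma> * ((if even (Suc (2*m)) then stretch else retract) z
        - (if even (Suc (2*m)) then stretch else retract) (soln (code x) (2 * Suc m)))"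
      using retract[OF soln_near'[of "2 * Suc m"]] by simp
  qed (use that \<sigma> \<open>0 < c\<close> in auto)
  have "accessible (draw ` code ` tent_core s) (draw (code x))"
    using corner code_orbit x \<sigma> by (intro accessible_draw[where n = "2 * i" and \<sigma> = \<sigma>]) auto
  then show ?thesis by (simp add: embed_def image_image)
qed

lemma accessible_left:
  assumes "x \<in> arc_component (tent_core s) left.base"
  shows "accessible (embed ` tent_core s) (embed x)"
proof -
  \<comment> \<open>A third of the distance to the nearer end of the branch, so that the
    \<open>2*e\<close>-neighbourhood of the fixed point leaves a margin \<open>e\<close> to
    \<open>A\<close>.\<close>
  define e where "e = min (left.p - A) (B - left.p) / 3"
  have e: "0 < e" "A + e \<le> left.p - 2*e" "left.p + 2*e \<le> B" "e \<le> 1"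
  proof -
    have "0 < e" "3 * e \<le> left.p - A" "3 * e \<le> B - left.p"
      using left.p_interior by (auto simp: e_def)
    then show "0 < e" "A + e \<le> left.p - 2*e" "left.p + 2*e \<le> B" "e \<le> 1"
      using order by linarith+
  qed
  obtain M where M: "\<And>k. M \<le> k \<Longrightarrow> \<bar>x (k * N) - left.p\<bar> < e"
    using left.component_tail[OF assms e(1)] by metis
  have "x \<in> tent_core s" using assms left.component_dense by (auto simp: dense_subset_def)
  then show ?thesis
  proof (rule accessible_embed[where \<sigma> = 1 and c = "e / 6" and p = left.p and e = e and M = M])
    fix y z :: real assume y: "\<bar>y - left.p\<bar> \<le> 2*e" and z: "\<bar>z\<bar> \<le> 3"
    have yAB: "A + e \<le> y" "y \<le> B" using y e by linarith+
    show "1 * (stretch z - stretch y) \<le> e / 6 * (1 * (z - y))" if "1 * (z - y) \<le> 0"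
    proof -
      have sy: "stretch y = lo + s ^ N * (y - A)"
        using yAB order e left.branch_affine[of y] by (simp add: stretch_def max_def min_def)
      \<comment> \<open>Left of \<open>A\<close> the map \<open>stretch\<close> is constant, but its
        drop from \<open>y\<close> is at least \<open>e\<close> over a distance of at most 6, which
        gives the slope \<open>e / 6\<close>. In the branch the slope is
        \<open>s ^ N > 1\<close>.\<close>
      show ?thesis
      proof (cases "z < A")
        case True
        then have "stretch z = lo" using order by (simp add: stretch_def max_def min_def iterate_ends)
        moreover have "1 * e \<le> s ^ N * (y - A)" using slope yAB e by (intro mult_mono) auto
        moreover have "e / 6 * (y - z) \<le> e / 6 * 6" using z yAB order e by (intro mult_left_mono) auto
        ultimately show ?thesis using sy by (simp add: algebra_simps)
      next
        case False
        then have "stretch z = lo + s ^ N * (z - A)"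
          using yAB that order left.branch_affine[of z] by (simp add: stretch_def max_def min_def)
        then have "stretch z - stretch y = s ^ N * (z - y)" using sy by (simp add: algebra_simps)
        also have "\<dots> \<le> e / 6 * (z - y)" using slope e that by (intro mult_right_mono_neg) auto
        finally show ?thesis by simp
      qed
    qed
    \<comment> \<open>Past \<open>D\<close> the fold returns to values at least \<open>C\<close>,
      which are not below \<open>y \<le> B\<close>.\<close>
    show "0 \<le> 1 * (retract z - retract y)" if "0 \<le> 1 * (z - y)"
      using that yAB order e retract_middle[of y] retract_middle[of z] retract_right_range[of z]
      by (cases "z \<le> D") auto
  qed (use e M order in auto)
qed

text \<open>The mirror image: \<open>\<sigma> = -1\<close> selects the opposite quadrant, and the
  estimates are made from the upper end \<open>D\<close>, beyond which \<open>stretch\<close> is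
  constantly \<open>hi\<close>.\<close>

lemma accessible_right:
  assumes "x \<in> arc_component (tent_core s) right.base"
  shows "accessible (embed ` tent_core s) (embed x)"
proof -
  define e where "e = min (right.p - C) (D - right.p) / 3"
  have e: "0 < e" "C \<le> right.p - 2*e" "right.p + 2*e \<le> D - e" "e \<le> 1"
  proof -
    have "0 < e" "3 * e \<le> right.p - C" "3 * e \<le> D - right.p"
      using right.p_interior by (auto simp: e_def)
    then show "0 < e" "C \<le> right.p - 2*e" "right.p + 2*e \<le> D - e" "e \<le> 1"
      using order by linarith+
  qed
  obtain M where M: "\<And>k. M \<le> k \<Longrightarrow> \<bar>x (k * N) - right.p\<bar> < e"
    using right.component_tail[OF assms e(1)] by metis
  have "x \<in> tent_core s" using assms right.component_dense by (auto simp: dense_subset_def)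
  then show ?thesis
  proof (rule accessible_embed[where \<sigma> = "-1" and c = "e / 6" and p = right.p and e = e and M = M])
    fix y z :: real assume y: "\<bar>y - right.p\<bar> \<le> 2*e" and z: "\<bar>z\<bar> \<le> 3"
    have yCD: "C \<le> y" "y \<le> D - e" using y e by linarith+
    show "- 1 * (stretch z - stretch y) \<le> e / 6 * (- 1 * (z - y))" if "- 1 * (z - y) \<le> 0"
    proof -
      have affine: "stretch w = hi - s ^ N * (D - w)" if "C \<le> w" "w \<le> D" for w
      proof -
        have "stretch w = lo + s ^ N * (w - C)"
          using that order right.branch_affine[of w] by (simp add: stretch_def max_def min_def)
        also have "\<dots> = lo + s ^ N * width - s ^ N * (C + width - w)" for width
          by (simp add: algebra_simps)
        finally show ?thesis using left.slope_width by (metis add_diff_cancel_left' diff_add_cancel)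
      qed
      have sy: "stretch y = hi - s ^ N * (D - y)" using yCD e by (intro affine) auto
      show ?thesis
      proof (cases "D < z")
        case True
        then have "stretch z = hi" using order by (simp add: stretch_def max_def min_def iterate_ends)
        moreover have "1 * e \<le> s ^ N * (D - y)" using slope yCD e by (intro mult_mono) auto
        moreover have "e / 6 * (z - y) \<le> e / 6 * 6" using z yCD order e by (intro mult_left_mono) auto
        ultimately show ?thesis using sy by (simp add: algebra_simps)
      next
        case False
        then have "stretch z = hi - s ^ N * (D - z)" using yCD that by (intro affine) auto
        then have "- 1 * (stretch z - stretch y) = s ^ N * (y - z)" using sy by (simp add: algebra_simps)
        also have "\<dots> \<le> e / 6 * (y - z)" using slope e that by (intro mult_right_mono_neg) auto
        finally show ?thesis by simp
      qed
    qed
    show "0 \<le> - 1 * (retract z - retract y)" if "0 \<le> - 1 * (z - y)"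
      using that yCD order e retract_middle[of y] retract_middle[of z] retract_left_range[of z]
      by (cases "A \<le> z") auto
  qed (use e M order in auto)
qed

end

section \<open>Compactness of the core and conclusion\<close>

lemma compact_tent_core: "compact (tent_core s)"
proof -
  let ?I = "{tent s (tent s (1/2)) .. tent s (1/2)}"
  have "compactin (product_topology (\<lambda>_. euclidean) UNIV) (PiE UNIV (\<lambda>_::nat. ?I))"
    by (simp add: compactin_PiE)
  then have "compact (PiE UNIV (\<lambda>_::nat. ?I))"
    by (simp add: euclidean_product_topology)
  moreover have "closed {x :: nat \<Rightarrow> real. \<forall>n. tent s (x (Suc n)) = x n}"
  proof -
    have coord: "continuous_on UNIV (\<lambda>x :: nat \<Rightarrow> real. x n)" for n
      by (rule continuous_on_product_coordinates)
    show ?thesis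
      by (intro closed_Collect_all closed_Collect_eq coord)
        (auto simp: tent_def intro!: continuous_intros coord)
  qed
  moreover have "tent_core s = PiE UNIV (\<lambda>_. ?I) \<inter> {x. \<forall>n. tent s (x (Suc n)) = x n}"
    by (auto simp: tent_core_def inverse_limit_def)
  ultimately show ?thesis by (simp only: compact_Int_closed)
qed

theorem theorem11p2:
  fixes s :: real
  assumes "sqrt 2 < s" and "s \<le> 2"
  shows "\<exists>h. planar_embedding (tent_core s) h \<and>
    (\<exists>C D. C \<noteq> D \<and>
      (\<forall>E\<in>{C, D}. E \<in> arc_components (h ` tent_core s) \<and> nondegenerate E \<and>
        fully_accessible (h ` tent_core s) E \<and> dense_subset (h ` tent_core s) E))"
proof -
  have s: "tent_map s" using assms by unfold_locales
  obtain N A C where "tent_map.full_branch s N A" "tent_map.full_branch s N C"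
      "A + (tent_map.hi s - tent_map.lo s) / s ^ N \<le> C"
    using tent_map.full_branches_exist[OF s] by metis
  then interpret two_branches s N A C
    using s by (simp add: two_branches_def two_branches_axioms_def tent_branch_def tent_branch_axioms_def)
  let ?K = "tent_core s"
  \<comment> \<open>A continuous injection of a compact set is a homeomorphism onto its image, so
    arc-components correspond.\<close>
  obtain k where homeo: "homeomorphism ?K (embed ` ?K) embed k"
    using homeomorphism_compact[OF compact_tent_core continuous_embed refl inj_embed] by blast
  have "planar_embedding ?K embed"
    unfolding planar_embedding_def
    using continuous_embed compact_tent_core inj_embed
    by (intro continuous_imp_embedding_map) (auto simp: compact_space_subtopology)
  moreover define E where "E b = arc_component (embed ` ?K) (embed b)" for b
  have E: "E b \<in> arc_components (embed ` ?K) \<and> nondegenerate (E b) \<and>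
      fully_accessible (embed ` ?K) (E b) \<and> dense_subset (embed ` ?K) (E b)"
    if b: "b \<in> ?K" and "nondegenerate (arc_component ?K b)" and dense: "dense_subset ?K (arc_component ?K b)"
      and acc: "\<And>x. x \<in> arc_component ?K b \<Longrightarrow> accessible (embed ` ?K) (embed x)" for b
  proof (intro conjI)
    have Eb: "E b = embed ` arc_component ?K b"
      unfolding E_def by (rule arc_component_homeomorphic_image[OF homeo b])
    have sub: "arc_component ?K b \<subseteq> ?K" using dense by (simp add: dense_subset_def)
    show "E b \<in> arc_components (embed ` ?K)" using b by (auto simp: E_def arc_components_def)
    show "nondegenerate (E b)"
      unfolding nondegenerate_def
    proof
      assume "\<exists>a. E b = {a}"
      then have "\<And>x. x \<in> arc_component ?K b \<Longrightarrow> embed x = embed b"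
        by (auto simp: Eb arc_component_def)
      then have "arc_component ?K b = {b}"
        using sub b inj_embed by (auto simp: inj_on_def arc_component_def)
      then show False using that(2) by (simp add: nondegenerate_def)
    qed
    show "fully_accessible (embed ` ?K) (E b)" using acc by (auto simp: Eb fully_accessible_def)
    have "closure (arc_component ?K b) = ?K"
      using dense sub compact_imp_closed[OF compact_tent_core]
      by (intro antisym closure_minimal) (auto simp: dense_subset_def)
    then have "embed ` ?K \<subseteq> closure (E b)"
      using continuous_image_closure_subset[OF continuous_embed, of "arc_component ?K b"] by (simp add: Eb)
    then show "dense_subset (embed ` ?K) (E b)" using sub by (auto simp: dense_subset_def Eb)
  qed
  \<comment> \<open>The coordinates of \<open>left.base\<close> at multiples of \<open>N\<close> all
    equal \<open>left.p\<close>, while those of a point in the other arc-component would tend to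
    \<open>right.p > left.p\<close>.\<close>
  have "E left.base \<noteq> E right.base"
  proof
    assume "E left.base = E right.base"
    then have "embed left.base \<in> embed ` arc_component ?K right.base"
      using arc_component_homeomorphic_image[OF homeo right.base_core]
      by (auto simp: E_def arc_component_def)
    then have "left.base \<in> arc_component ?K right.base"
      using inj_embed left.base_core right.component_dense
      by (auto simp: inj_on_def dense_subset_def)
    then obtain M where M: "\<And>k. M \<le> k \<Longrightarrow> \<bar>left.base (k * N) - right.p\<bar> < right.p - left.p"
      using right.component_tail[of left.base "right.p - left.p"] left.p_interior right.p_interior order
      by (metis diff_gt_0_iff_gt less_le_trans less_trans)
    then show False using M[of M] left.p_interior right.p_interior order by (simp add: left.base_at)
  qed
  then show ?thesis
    using calculation E[OF left.base_core left.component_nondegenerate left.component_dense accessible_left]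
      E[OF right.base_core right.component_nondegenerate right.component_dense accessible_right]
    by (intro exI[of _ embed] conjI exI[of _ "E left.base"] exI[of _ "E right.base"]) auto
qed

end
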